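(* Let $G$ be a finite simple graph with maximum degree $\Delta(G)\geq 10$ and maximum average degree $\operatorname{mad}(G)<\frac{14}{5}$. Then $G$ admits a $2$-distance $(\Delta(G)+2)$-coloring.
   Context: For a finite simple graph $G$, $\Delta(G)$ is its maximum degree. The maximum average degree $\operatorname{mad}(G)$ is the maximum, over all (nonempty) subgraphs $H$ of $G$, of $\frac{2|E(H)|}{|V(H)|}$. A $2$-distance $k$-coloring of $G$ is a map $\phi:V(G)\to\{1,\dots,k\}$ such that $\phi(x)\neq\phi(y)$ for any two distinct vertices $x,y$ at distance at most $2$ in $G$. *)

theory Defs
  imports "Graph_Theory.Graph_Theory"
begin

text \<open>
  Finite simple graphs are the \<open>pair_graph\<close>s: finite, symmetric, loop-free sets of ordered
  pairs. An undirected edge is thus represented by its two opposite arcs, so the degree of a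
  vertex is its out-degree, and \<open>E(H)\<close> is obtained by forgetting the direction of the arcs.
\<close>

definition edges :: "'a pair_pre_digraph \<Rightarrow> 'a set set" where
  "edges G = (\<lambda>(u, v). {u, v}) ` parcs G"

text \<open>The \<open>0\<close> only fixes the value for the graph without vertices.\<close>

definition max_degree :: "'a pair_pre_digraph \<Rightarrow> nat" where
  "max_degree G = Max (insert 0 (out_degree (with_proj G) ` pverts G))"

text \<open>
  The library's \<open>subgraph\<close> relates digraphs; requiring \<open>pair_graph H\<close> singles out those that
  are undirected, i.e. contain with every arc its reverse.
\<close>

definition nonempty_subgraphs :: "'a pair_pre_digraph \<Rightarrow> 'a pair_pre_digraph set" where
  "nonempty_subgraphs G =
     {H. pair_graph H \<and> subgraph (with_proj H) (with_proj G) \<and> pverts H \<noteq> {}}"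

definition mad :: "'a pair_pre_digraph \<Rightarrow> real" where
  "mad G = Max ((\<lambda>H. 2 * real (card (edges H)) / real (card (pverts H))) ` nonempty_subgraphs G)"

text \<open>
  The distance is the library's shortest-path length for unit arc weights; it is \<open>\<infinity>\<close> between
  different components.
\<close>

definition graph_dist :: "'a pair_pre_digraph \<Rightarrow> 'a \<Rightarrow> 'a \<Rightarrow> ereal" where
  "graph_dist G u v = wf_digraph.\<mu> (with_proj G) (\<lambda>_. 1) u v"

definition two_distance_coloring :: "'a pair_pre_digraph \<Rightarrow> nat \<Rightarrow> ('a \<Rightarrow> nat) \<Rightarrow> bool" where
  "two_distance_coloring G k \<phi> \<longleftrightarrow>
     \<phi> ` pverts G \<subseteq> {1..k} \<and>
     (\<forall>x\<in>pverts G. \<forall>y\<in>pverts G. x \<noteq> y \<and> graph_dist G x y \<le> 2 \<longrightarrow> \<phi> x \<noteq> \<phi> y)"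

text \<open>The maximum in \<open>mad\<close> is attained whenever the graph has a vertex.\<close>

lemma finite_nonempty_subgraphs:
  assumes "pair_graph G"
  shows "finite (nonempty_subgraphs G)"
proof -
  interpret pair_graph G by fact
  have "nonempty_subgraphs G \<subseteq>
      (\<lambda>(V, A). \<lparr>pverts = V, parcs = A\<rparr>) ` (Pow (pverts G) \<times> Pow (parcs G))"
  proof
    fix H assume "H \<in> nonempty_subgraphs G"
    then have "pverts H \<subseteq> pverts G" "parcs H \<subseteq> parcs G"
      by (auto simp: nonempty_subgraphs_def subgraph_def)
    then show "H \<in> (\<lambda>(V, A). \<lparr>pverts = V, parcs = A\<rparr>) ` (Pow (pverts G) \<times> Pow (parcs G))"
      by (intro image_eqI[where x = "(pverts H, parcs H)"]) auto
  qed
  then show ?thesis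
    by (rule finite_subset) (simp add: pair_finite_verts pair_finite_arcs)
qed

lemma self_in_nonempty_subgraphs:
  assumes "pair_graph G" "pverts G \<noteq> {}"
  shows "G \<in> nonempty_subgraphs G"
proof -
  interpret pair_graph G by fact
  show ?thesis
    using assms by (simp add: nonempty_subgraphs_def subgraph_def compatible_def wf_digraph)
qed

lemma graph_dist_le_2_iff:
  assumes "pair_graph G" "x \<in> pverts G" "y \<in> pverts G"
  shows "graph_dist G x y \<le> 2 \<longleftrightarrow>
    x = y \<or> (x, y) \<in> parcs G \<or> (\<exists>z. (x, z) \<in> parcs G \<and> (z, y) \<in> parcs G)"
proof -
  interpret pair_graph G by fact
  have cost: "awalk_cost (\<lambda>_. 1) p = real (length p)" for p :: "('a \<times> 'a) list"
    by (simp add: awalk_cost_def sum_list_triv)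
  have dist: "graph_dist G x y = (INF p\<in>{p. awalk x p y}. ereal (real (length p)))"
    by (simp add: graph_dist_def \<mu>_def cost)
  have "graph_dist G x y \<le> 2 \<longleftrightarrow> (\<exists>p. awalk x p y \<and> length p \<le> 2)"
  proof
    assume "graph_dist G x y \<le> 2"
    then have "graph_dist G x y < ereal 3"
      by (rule le_less_trans) simp
    then obtain p where "awalk x p y" "ereal (real (length p)) < ereal 3"
      unfolding dist INF_less_iff by blast
    then show "\<exists>p. awalk x p y \<and> length p \<le> 2"
      by (intro exI[of _ p]) simp
  next
    assume "\<exists>p. awalk x p y \<and> length p \<le> 2"
    then obtain p where p: "awalk x p y" "length p \<le> 2" by blast
    have "graph_dist G x y \<le> ereal (real (length p))"
      unfolding dist using p(1) by (intro INF_lower) simp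
    also have "\<dots> \<le> ereal 2"
      using p(2) by simp
    finally show "graph_dist G x y \<le> 2" by simp
  qed
  also have "\<dots> \<longleftrightarrow>
      x = y \<or> (x, y) \<in> parcs G \<or> (\<exists>z. (x, z) \<in> parcs G \<and> (z, y) \<in> parcs G)"
    (is "?L \<longleftrightarrow> ?R")
  proof
    assume ?L
    then obtain p where p: "awalk x p y" "length p \<le> 2" by blast
    then consider "p = []" | e where "p = [e]" | e f where "p = [e, f]"
      by (cases p; cases "tl p") auto
    then show ?R
      using p(1) by cases (auto simp: awalk_def)
  next
    assume ?R
    then consider "x = y" | "(x, y) \<in> parcs G"
      | z where "(x, z) \<in> parcs G" "(z, y) \<in> parcs G" by blast
    then show ?L
    proof cases
      case 1
      then show ?thesis using assms by (intro exI[of _ "[]"]) (simp add: awalk_Nil_iff)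
    next
      case 2
      then show ?thesis using assms by (intro exI[of _ "[(x, y)]"]) (simp add: awalk_def)
    next
      case (3 z)
      then show ?thesis using assms by (intro exI[of _ "[(x, z), (z, y)]"]) (simp add: awalk_def)
    qed
  qed
  finally show ?thesis .
qed

end

theory Submission
  imports Defs
begin

text \<open>
  Write \<open>k\<close> for the maximum degree. Suppose some graph of maximum degree at most \<open>k\<close> and small
  maximum average degree has no \<open>2\<close>-distance colouring with \<open>k + 2\<close> colours, and take one with as few
  edges as possible. The proof shows that such a critical graph has average degree at least \<open>14/5\<close>,
  which is the content of \<open>critical_graph_dense\<close>.

  Deleting an edge inside a set \<open>S\<close> of vertices and colouring the smaller graph gives a colouring of
  the original graph that can only be wrong at \<open>S\<close> (\<open>free_of_edge\<close>). If the vertices of \<open>S\<close> can then be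
  recoloured, the graph was not critical. A vertex sees at most as many vertices within distance two as
  the degrees of its neighbours add up to, so this excludes many configurations around vertices of degree
  \<open>2\<close>: there are no leaves, two adjacent \<open>2\<close>-vertices hang between vertices of degree exactly \<open>k\<close>
  (\<open>adjacent_2_vertices\<close>), two \<open>2\<close>-vertices at a common \<open>3\<close>-vertex lead to vertices of degree
  \<open>k\<close> unless the third neighbour has large degree (\<open>two_2_vertices_at_3_vertex\<close>), and a
  \<open>2\<close>-vertex that can always be coloured last forces its neighbours to have neighbours whose degrees
  have a large sum (\<open>light_nbr\<close>).

  Two local configurations survive, and both are short of charge in the discharging below: adjacent
  \<open>2\<close>-vertices, and \<open>3\<close>-vertices with three neighbours of degree \<open>2\<close>. Each of them connects
  vertices of degree \<open>k\<close>, and these connections contain no cycle: along a cycle the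
  \<open>2\<close>-vertices next to the vertices of degree \<open>k\<close> would, once uncoloured, have two colours each and
  form cycles of even length in the conflict graph, and even cycles are \<open>2\<close>-choosable. Hence there are
  at most as many connections as vertices of degree \<open>k\<close> (\<open>connectors_le_hubs\<close>), and each of the
  latter can afford to pay for one connection.

  For the discharging, a vertex of degree \<open>d\<close> has charge \<open>10 d - 28\<close>. Vertices of degree at least \<open>5\<close>
  give their charge away evenly, and vertices of degree \<open>3\<close> and \<open>4\<close> support their neighbours of degree
  \<open>2\<close>. A vertex of degree \<open>k\<close> gives \<open>7\<close> to each neighbour and \<open>2\<close> to the connections; this is possible
  precisely if \<open>10 k - 28 \<ge> 7 k + 2\<close>, that is, if \<open>k \<ge> 10\<close>.
\<close>

section \<open>Colouring cycles formed by two perfect matchings\<close>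

definition pairing :: "'b set \<Rightarrow> ('b \<Rightarrow> 'b) \<Rightarrow> bool" where
  "pairing S m \<longleftrightarrow> (\<forall>v\<in>S. m v \<in> S \<and> m (m v) = v \<and> m v \<noteq> v)"

lemma pairing_remove_pair:
  assumes "pairing S m" "v \<in> S"
  shows "pairing (S - {v, m v}) m"
  using assms unfolding pairing_def by (metis Diff_iff insert_iff empty_iff)

lemma other_element:
  assumes "2 \<le> card X"
  obtains y where "y \<in> X" "y \<noteq> c"
proof -
  have "\<not> X \<subseteq> {c}" using card_mono[of "{c}" X] assms by auto
  then show ?thesis using that by blast
qed

text \<open>
  The union of two perfect matchings is a disjoint union of even cycles (or doubled edges), and the
  first half is their \<open>2\<close>-choosability. The second half lets \<open>\<sigma>\<close> miss \<open>p\<close> and \<open>q\<close>, so that they are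
  the ends of a path, and allows a one-element list at \<open>p\<close>: colours can be chosen greedily
  from \<open>p\<close> onwards. Both halves are proved together by induction on the number of vertices, since
  colouring two vertices of a cycle leaves a path, and reaching the end of the path leaves only cycles.
\<close>

lemma pairings_and_path_choosable:
  fixes \<tau> :: "'b \<Rightarrow> 'b"
  assumes "finite S"
  shows "(\<forall>\<sigma> (L :: 'b \<Rightarrow> 'c set). pairing S \<sigma> \<longrightarrow> pairing S \<tau> \<longrightarrow> (\<forall>v\<in>S. 2 \<le> card (L v)) \<longrightarrow>
      (\<exists>f. \<forall>v\<in>S. f v \<in> L v \<and> f v \<noteq> f (\<sigma> v) \<and> f v \<noteq> f (\<tau> v)))
    \<and> (\<forall>\<sigma> (L :: 'b \<Rightarrow> 'c set) p q. p \<in> S \<longrightarrow> q \<in> S \<longrightarrow> p \<noteq> q \<longrightarrow> pairing (S - {p, q}) \<sigma> \<longrightarrow> pairing S \<tau> \<longrightarrow>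
      L p \<noteq> {} \<longrightarrow> (\<forall>v\<in>S - {p}. 2 \<le> card (L v)) \<longrightarrow>
      (\<exists>f. (\<forall>v\<in>S. f v \<in> L v \<and> f v \<noteq> f (\<tau> v)) \<and> (\<forall>v\<in>S - {p, q}. f v \<noteq> f (\<sigma> v))))"
  using assms
proof (induction "card S" arbitrary: S rule: less_induct)
  case less
  note fin = \<open>finite S\<close>
  have smaller: "card S' < card S" "finite S'" if "S' \<subset> S" for S'
    using that psubset_card_mono[OF fin] finite_subset[OF _ fin] by blast+
  have cycles: "\<exists>f. \<forall>v\<in>S'. f v \<in> L v \<and> f v \<noteq> f (\<sigma> v) \<and> f v \<noteq> f (\<tau> v)"
    if "S' \<subset> S" "pairing S' \<sigma>" "pairing S' \<tau>" "\<forall>v\<in>S'. 2 \<le> card (L v)"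
    for S' \<sigma> and L :: "'b \<Rightarrow> 'c set"
    by (rule less.hyps[OF smaller[OF that(1)], THEN conjunct1, THEN spec[of _ \<sigma>], THEN spec[of _ L],
          THEN mp, THEN mp, THEN mp, OF that(2-4)])
  have path: "\<exists>f. (\<forall>v\<in>S'. f v \<in> L v \<and> f v \<noteq> f (\<tau> v)) \<and> (\<forall>v\<in>S' - {p, q}. f v \<noteq> f (\<sigma> v))"
    if "S' \<subset> S" "p \<in> S'" "q \<in> S'" "p \<noteq> q" "pairing (S' - {p, q}) \<sigma>" "pairing S' \<tau>"
       "L p \<noteq> {}" "\<forall>v\<in>S' - {p}. 2 \<le> card (L v)"
    for S' \<sigma> p q and L :: "'b \<Rightarrow> 'c set"
    by (rule less.hyps[OF smaller[OF that(1)], THEN conjunct2, THEN spec[of _ \<sigma>], THEN spec[of _ L],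
          THEN spec[of _ p], THEN spec[of _ q], THEN mp, THEN mp, THEN mp, THEN mp, THEN mp, THEN mp,
          THEN mp, OF that(2-8)])
  show ?case
  proof (intro conjI allI impI)
    fix \<sigma> and L :: "'b \<Rightarrow> 'c set"
    assume \<sigma>: "pairing S \<sigma>" and \<tau>: "pairing S \<tau>" and L: "\<forall>v\<in>S. 2 \<le> card (L v)"
    note \<sigma>' = \<sigma>[unfolded pairing_def, rule_format] and \<tau>' = \<tau>[unfolded pairing_def, rule_format]
    show "\<exists>f. \<forall>v\<in>S. f v \<in> L v \<and> f v \<noteq> f (\<sigma> v) \<and> f v \<noteq> f (\<tau> v)"
    proof (cases "S = {}")
      case False
      then obtain a where a: "a \<in> S" by blast
      define b where "b = \<tau> a"
      define R where "R = S - {a, b}"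
      have b: "b \<in> S" "b \<noteq> a" "\<tau> b = a" using \<tau>'[OF a] by (auto simp: b_def)
      have R: "R \<subset> S" "pairing R \<tau>" using a pairing_remove_pair[OF \<tau> a] by (auto simp: R_def b_def)
      have \<tau>R: "\<tau> v \<in> R" if "v \<in> R" for v using R(2) that by (auto simp: pairing_def)
      have LR: "\<forall>v\<in>R. 2 \<le> card (L v)" using L R(1) by blast
      show ?thesis
      proof (cases "\<sigma> a = b")
        case True
        then have "pairing R \<sigma>" using pairing_remove_pair[OF \<sigma> a] by (simp add: R_def)
        from cycles[OF R(1) this R(2) LR] obtain f
          where f: "\<forall>v\<in>R. f v \<in> L v \<and> f v \<noteq> f (\<sigma> v) \<and> f v \<noteq> f (\<tau> v)" by blast
        obtain y where y: "y \<in> L a" using other_element[OF L[rule_format, OF a]] .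
        obtain z where z: "z \<in> L b" "z \<noteq> y" using other_element[OF L[rule_format, OF b(1)]] .
        have \<sigma>R: "\<sigma> v \<in> R" if "v \<in> R" for v using \<open>pairing R \<sigma>\<close> that by (auto simp: pairing_def)
        have "\<sigma> b = a" using \<sigma>'[OF a] True by metis
        have nR: "a \<notin> R" "b \<notin> R" by (auto simp: R_def)
        show ?thesis
        proof (intro exI[of _ "f(a := y, b := z)"] ballI)
          fix v assume "v \<in> S"
          then consider "v = a" | "v = b" | "v \<in> R" by (auto simp: R_def)
          then show "(f(a := y, b := z)) v \<in> L v \<and> (f(a := y, b := z)) v \<noteq> (f(a := y, b := z)) (\<sigma> v)
              \<and> (f(a := y, b := z)) v \<noteq> (f(a := y, b := z)) (\<tau> v)"
          proof cases
            case 3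
            then have "v \<noteq> a" "v \<noteq> b" "\<sigma> v \<noteq> a" "\<sigma> v \<noteq> b" "\<tau> v \<noteq> a" "\<tau> v \<noteq> b"
              using \<tau>R[OF 3] \<sigma>R[OF 3] nR 3 by auto
            then show ?thesis using f 3 by simp
          qed (use b True \<open>\<sigma> b = a\<close> b_def y z in auto)
        qed
      next
        case False
        define a' where "a' = \<sigma> a"
        define b' where "b' = \<sigma> b"
        have ends: "a' \<in> R" "b' \<in> R" "a' \<noteq> b'" "\<sigma> a' = a" "\<sigma> b' = b"
          using \<sigma>'[OF a] \<sigma>'[OF b(1)] False b(2) by (auto simp: a'_def b'_def R_def)
        have nR: "a \<notin> R" "b \<notin> R" by (auto simp: R_def)
        have \<sigma>in: "\<sigma> v \<in> R - {a', b'}" if "v \<in> R - {a', b'}" for v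
        proof -
          have v: "v \<in> S" using that by (auto simp: R_def)
          have "\<sigma> v \<noteq> x" if "v \<noteq> \<sigma> x" for x using \<sigma>'[OF v] that by auto
          from this[of a] this[of b] this[of a'] this[of b'] show ?thesis
            using \<sigma>'[OF v] ends that unfolding R_def by (auto simp: a'_def b'_def)
        qed
        have R\<sigma>: "pairing (R - {a', b'}) \<sigma>"
          using \<sigma>in \<sigma>' R(1) unfolding pairing_def by blast
        have extend: "\<exists>f. \<forall>v\<in>S. f v \<in> L v \<and> f v \<noteq> f (\<sigma> v) \<and> f v \<noteq> f (\<tau> v)"
          if f: "\<forall>v\<in>R. f v \<in> L v \<and> f v \<noteq> f (\<tau> v)" "\<forall>v\<in>R - {a', b'}. f v \<noteq> f (\<sigma> v)"
            and yz: "y \<in> L a" "z \<in> L b" "y \<noteq> z" "y \<noteq> f a'" "z \<noteq> f b'" for f y z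
        proof (intro exI[of _ "f(a := y, b := z)"] ballI)
          fix v assume "v \<in> S"
          then consider "v = a" | "v = b" | "v = a'" | "v = b'" | "v \<in> R - {a', b'}" by (auto simp: R_def)
          then show "(f(a := y, b := z)) v \<in> L v \<and> (f(a := y, b := z)) v \<noteq> (f(a := y, b := z)) (\<sigma> v)
              \<and> (f(a := y, b := z)) v \<noteq> (f(a := y, b := z)) (\<tau> v)"
          proof cases
            case 1
            then show ?thesis using yz b ends nR a'_def b_def by auto
          next
            case 2
            then show ?thesis using yz b ends nR b'_def by auto
          next
            case 3
            then have "v \<in> R" "\<tau> v \<in> R" "v \<noteq> a" "v \<noteq> b" "\<tau> v \<noteq> a" "\<tau> v \<noteq> b" "\<sigma> v = a"
              using 3 \<tau>R[OF ends(1)] nR ends by auto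
            then show ?thesis using f yz 3 b(2) by auto
          next
            case 4
            then have "v \<in> R" "\<tau> v \<in> R" "v \<noteq> a" "v \<noteq> b" "\<tau> v \<noteq> a" "\<tau> v \<noteq> b" "\<sigma> v = b"
              using 4 \<tau>R[OF ends(2)] nR ends by auto
            then show ?thesis using f yz 4 b(2) by auto
          next
            case 5
            then have "v \<in> R" "\<tau> v \<in> R" "\<sigma> v \<in> R" using \<tau>R \<sigma>in by blast+
            then have "v \<noteq> a" "v \<noteq> b" "\<sigma> v \<noteq> a" "\<sigma> v \<noteq> b" "\<tau> v \<noteq> a" "\<tau> v \<noteq> b"
              using nR by auto
            then show ?thesis using f 5 by simp
          qed
        qed
        \<comment> \<open>Two colours common to both lists allow to contract the path from \<open>a'\<close> over \<open>a\<close> and \<open>b\<close> to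
          \<open>b'\<close> into an edge: different colours at its ends can always be extended to the middle.\<close>
        show ?thesis
        proof (cases "L a \<subseteq> L b")
          case True
          obtain c where c: "c \<in> L a" using other_element[OF L[rule_format, OF a]] .
          obtain d where d: "d \<in> L a" "d \<noteq> c" using other_element[OF L[rule_format, OF a]] .
          let ?\<sigma> = "\<sigma>(a' := b', b' := a')"
          have "pairing R ?\<sigma>"
            using R\<sigma> ends unfolding pairing_def by (auto simp: fun_upd_def)
          from cycles[OF R(1) this R(2) LR] obtain f
            where f: "\<forall>v\<in>R. f v \<in> L v \<and> f v \<noteq> f (?\<sigma> v) \<and> f v \<noteq> f (\<tau> v)" by blast
          have ne: "f a' \<noteq> f b'" using bspec[OF f ends(1)] ends(3) by auto
          have f2: "\<forall>v\<in>R. f v \<in> L v \<and> f v \<noteq> f (\<tau> v)" "\<forall>v\<in>R - {a', b'}. f v \<noteq> f (\<sigma> v)"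
            using f by auto
          show ?thesis
          proof (cases "f a' \<noteq> c \<and> f b' \<noteq> d")
            case True
            then show ?thesis using extend[OF f2, of c d] c d \<open>L a \<subseteq> L b\<close> by blast
          next
            case False
            then have "d \<noteq> f a'" "c \<noteq> f b'" using ne d(2) by auto
            then show ?thesis using extend[OF f2, of d c] c d \<open>L a \<subseteq> L b\<close> by blast
          qed
        next
          case False
          \<comment> \<open>The colour \<open>c\<close> at \<open>a\<close> does no harm at \<open>b\<close>; the rest of the cycle is a path
            starting at \<open>a'\<close>, where only \<open>c\<close> is lost.\<close>
          then obtain c where c: "c \<in> L a" "c \<notin> L b" by blast
          obtain e where "e \<in> L a'" "e \<noteq> c" using other_element[OF LR[rule_format, OF ends(1)]] .
          then have "(L(a' := L a' - {c})) a' \<noteq> {}" by auto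
          moreover have "\<forall>v\<in>R - {a'}. 2 \<le> card ((L(a' := L a' - {c})) v)" using LR by simp
          ultimately obtain f where f:
            "\<forall>v\<in>R. f v \<in> (L(a' := L a' - {c})) v \<and> f v \<noteq> f (\<tau> v)" "\<forall>v\<in>R - {a', b'}. f v \<noteq> f (\<sigma> v)"
            using path[OF R(1) ends(1-3) R\<sigma> R(2)] by blast
          obtain z where z: "z \<in> L b" "z \<noteq> f b'" using other_element[OF L[rule_format, OF b(1)]] .
          have "\<forall>v\<in>R. f v \<in> L v \<and> f v \<noteq> f (\<tau> v)" using f(1) by (auto split: if_splits)
          moreover have "c \<noteq> f a'" using bspec[OF f(1) ends(1)] by auto
          ultimately show ?thesis using extend[OF _ f(2) c(1) z(1) _ _ z(2)] c(2) z(1) by blast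
        qed
      qed
    qed simp
  next
    fix \<sigma> and L :: "'b \<Rightarrow> 'c set" and p q
    assume pq: "p \<in> S" "q \<in> S" "p \<noteq> q" and \<sigma>: "pairing (S - {p, q}) \<sigma>" and \<tau>: "pairing S \<tau>"
      and Lp: "L p \<noteq> {}" and L: "\<forall>v\<in>S - {p}. 2 \<le> card (L v)"
    note \<tau>' = \<tau>[unfolded pairing_def, rule_format]
    define h where "h = \<tau> p"
    define R where "R = S - {p, h}"
    have h: "h \<in> S" "h \<noteq> p" "\<tau> h = p" using \<tau>'[OF pq(1)] by (auto simp: h_def)
    have R: "R \<subset> S" "pairing R \<tau>" using pq pairing_remove_pair[OF \<tau> pq(1)] by (auto simp: R_def h_def)
    have nR: "p \<notin> R" "h \<notin> R" by (auto simp: R_def)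
    have \<tau>R: "\<tau> v \<in> R" if "v \<in> R" for v using R(2) that by (auto simp: pairing_def)
    obtain y where y: "y \<in> L p" using Lp by blast
    obtain z where z: "z \<in> L h" "z \<noteq> y"
      using other_element[OF L[rule_format, of h]] h by blast
    show "\<exists>f. (\<forall>v\<in>S. f v \<in> L v \<and> f v \<noteq> f (\<tau> v)) \<and> (\<forall>v\<in>S - {p, q}. f v \<noteq> f (\<sigma> v))"
    proof -
      have "\<exists>f. (\<forall>v\<in>R. f v \<in> L v \<and> f v \<noteq> f (\<tau> v)) \<and>
          (\<forall>v\<in>S - {p, q}. (f(p := y, h := z)) v \<noteq> (f(p := y, h := z)) (\<sigma> v))"
      proof (cases "h = q")
        case True
        then have "pairing R \<sigma>" using \<sigma> by (simp add: R_def)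
        moreover have "\<forall>v\<in>R. 2 \<le> card (L v)" using L by (auto simp: R_def)
        ultimately obtain f where f: "\<forall>v\<in>R. f v \<in> L v \<and> f v \<noteq> f (\<sigma> v) \<and> f v \<noteq> f (\<tau> v)"
          using cycles[OF R(1)] R(2) by blast
        have "(f(p := y, h := z)) v \<noteq> (f(p := y, h := z)) (\<sigma> v)" if "v \<in> S - {p, q}" for v
        proof -
          have "v \<in> R" "\<sigma> v \<in> R" using that \<open>pairing R \<sigma>\<close> True by (auto simp: R_def pairing_def)
          then have "v \<noteq> p" "v \<noteq> h" "\<sigma> v \<noteq> p" "\<sigma> v \<noteq> h" using nR by auto
          then show ?thesis using f \<open>v \<in> R\<close> by simp
        qed
        then show ?thesis using f by blast
      next
        case False
        note \<sigma>' = \<sigma>[unfolded pairing_def, rule_format]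
        define r where "r = \<sigma> h"
        have hin: "h \<in> S - {p, q}" using h False by blast
        have r: "r \<in> R" "r \<noteq> q" "\<sigma> r = h" "r \<noteq> p" "r \<noteq> h"
          using \<sigma>'[OF hin] by (auto simp: r_def R_def)
        have qR: "q \<in> R" using pq False by (auto simp: R_def)
        have "R - {r, q} = (S - {p, q}) - {h, \<sigma> h}" by (auto simp: R_def r_def)
        then have pR: "pairing (R - {r, q}) \<sigma>" using pairing_remove_pair[OF \<sigma> hin] by simp
        obtain e where "e \<in> L r" "e \<noteq> z"
          using other_element[OF L[rule_format, of r]] r(1,4) R(1) by blast
        then have "(L(r := L r - {z})) r \<noteq> {}" by auto
        moreover have "\<forall>v\<in>R - {r}. 2 \<le> card ((L(r := L r - {z})) v)" using L by (auto simp: R_def)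
        ultimately obtain f where f:
          "\<forall>v\<in>R. f v \<in> (L(r := L r - {z})) v \<and> f v \<noteq> f (\<tau> v)" "\<forall>v\<in>R - {r, q}. f v \<noteq> f (\<sigma> v)"
          using path[OF R(1) r(1) qR r(2) pR R(2)] by blast
        have "f r \<noteq> z" using bspec[OF f(1) r(1)] by auto
        have "(f(p := y, h := z)) v \<noteq> (f(p := y, h := z)) (\<sigma> v)" if v: "v \<in> S - {p, q}" for v
        proof -
          consider "v = h" | "v = r" | "v \<in> R - {r, q}" using v by (auto simp: R_def)
          then show ?thesis
          proof cases
            case 3
            then have "\<sigma> v \<in> R" using pR by (auto simp: pairing_def)
            then have "v \<noteq> p" "v \<noteq> h" "\<sigma> v \<noteq> p" "\<sigma> v \<noteq> h" using nR 3 by blast+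
            then show ?thesis using f(2) 3 by simp
          qed (use r \<open>f r \<noteq> z\<close> h r_def in auto)
        qed
        moreover have "\<forall>v\<in>R. f v \<in> L v \<and> f v \<noteq> f (\<tau> v)" using f(1) by (auto split: if_splits)
        ultimately show ?thesis by blast
      qed
      then obtain f where f: "\<forall>v\<in>R. f v \<in> L v \<and> f v \<noteq> f (\<tau> v)"
        "\<forall>v\<in>S - {p, q}. (f(p := y, h := z)) v \<noteq> (f(p := y, h := z)) (\<sigma> v)" by blast
      have "(f(p := y, h := z)) v \<in> L v \<and> (f(p := y, h := z)) v \<noteq> (f(p := y, h := z)) (\<tau> v)"
        if v: "v \<in> S" for v
      proof -
        consider "v = p" | "v = h" | "v \<in> R" using v by (auto simp: R_def)
        then show ?thesis
        proof cases
          case 3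
          then have "v \<noteq> p" "v \<noteq> h" "\<tau> v \<noteq> p" "\<tau> v \<noteq> h" using nR \<tau>R[OF 3] by auto
          then show ?thesis using f(1) 3 by simp
        qed (use y z h h_def in auto)
      qed
      with f(2) show ?thesis by (intro exI[of _ "f(p := y, h := z)"]) blast
    qed
  qed
qed

lemma two_pairings_choosable:
  assumes "finite S" "pairing S \<sigma>" "pairing S \<tau>" "\<And>v. v \<in> S \<Longrightarrow> 2 \<le> card (L v)"
  obtains f where "\<And>v. v \<in> S \<Longrightarrow> f v \<in> L v \<and> f v \<noteq> f (\<sigma> v) \<and> f v \<noteq> f (\<tau> v)"
proof -
  have "\<forall>v\<in>S. 2 \<le> card (L v)" using assms(4) by blast
  with assms(2,3) obtain f where "\<forall>v\<in>S. f v \<in> L v \<and> f v \<noteq> f (\<sigma> v) \<and> f v \<noteq> f (\<tau> v)"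
    using pairings_and_path_choosable[OF assms(1), of \<tau>, THEN conjunct1,
        THEN spec[of _ \<sigma>], THEN spec[of _ L]] by auto
  then show ?thesis using that by blast
qed

section \<open>Two-regular subsystems\<close>

lemma pairing_even_card:
  assumes "finite S" "pairing S m"
  shows "even (card S)"
  using assms
proof (induction "card S" arbitrary: S rule: less_induct)
  case less
  show ?case
  proof (cases "S = {}")
    case False
    then obtain v where v: "v \<in> S" by blast
    with less.prems have mv: "m v \<in> S" "m v \<noteq> v" by (auto simp: pairing_def)
    then have c: "card (S - {v, m v}) = card S - 2"
      using v less.prems(1) by (subst card_Diff_subset) auto
    have "2 \<le> card S" using card_mono[of S "{v, m v}"] v mv less.prems(1) by auto
    then have "even (card (S - {v, m v}))"
      using less.hyps[of "S - {v, m v}"] pairing_remove_pair[OF less.prems(2) v] less.prems(1) c by simp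
    then show ?thesis using c \<open>2 \<le> card S\<close> by simp
  qed simp
qed

text \<open>
  View every pair \<open>{v, m v}\<close> as an edge between \<open>hub v\<close> and \<open>hub (m v)\<close>. A multigraph with at
  least as many edges as vertices contains a cycle; a smallest nonempty set of edges that touches at most
  as many vertices as it has edges is \<open>2\<close>-regular. A vertex met only once could be dropped
  together with its edge, so all degrees are at least two, and one edge too many could be dropped as well,
  so on average they are exactly two.
\<close>

lemma two_regular_subset:
  assumes "finite F" "F \<noteq> {}" "pairing F m" "2 * card (hub ` F) \<le> card F"
  obtains F' where "F' \<subseteq> F" "F' \<noteq> {}" "pairing F' m"
    "\<forall>v\<in>F'. card {w\<in>F'. hub w = hub v} = 2"
proof -
  define P where "P X \<longleftrightarrow> X \<subseteq> F \<and> X \<noteq> {} \<and> pairing X m \<and> 2 * card (hub ` X) \<le> card X" for X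
  have "P F" using assms by (simp add: P_def)
  then obtain X where PX: "P X" and min: "\<And>Y. P Y \<Longrightarrow> card X \<le> card Y"
    using ex_has_least_nat[of P F card] by blast
  have X: "X \<subseteq> F" "X \<noteq> {}" "pairing X m" "2 * card (hub ` X) \<le> card X" using PX by (auto simp: P_def)
  have finX: "finite X" using X(1) assms(1) finite_subset by blast
  have drop: "card (X - {v, m v}) = card X - 2" "2 \<le> card X" if "v \<in> X" for v
  proof -
    have mv: "m v \<in> X" "m v \<noteq> v" using X(3) that by (auto simp: pairing_def)
    show "card (X - {v, m v}) = card X - 2" using that mv finX by (subst card_Diff_subset) auto
    show "2 \<le> card X" using card_mono[of X "{v, m v}"] that mv finX by auto
  qed
  have notP: "\<not> P (X - {v, m v})" if "v \<in> X" for v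
    using min[of "X - {v, m v}"] drop[OF that] by linarith
  have hub_pos: "1 \<le> card (hub ` X)" using X(2) finX by (simp add: Suc_le_eq card_gt_0_iff)
  have P_smaller: "P (X - {v, m v})"
    if v: "v \<in> X" and c: "2 * card (hub ` (X - {v, m v})) + 2 \<le> card X" and "2 < card X" for v
  proof -
    have "X - {v, m v} \<noteq> {}" using drop[OF v] that(3) by (metis card.empty zero_less_diff less_irrefl)
    then show ?thesis using X pairing_remove_pair[OF X(3) v] drop[OF v] c by (auto simp: P_def)
  qed
  have eq: "card X = 2 * card (hub ` X)"
  proof (rule ccontr)
    assume "\<not> ?thesis"
    with X(4) pairing_even_card[OF finX X(3)] have gt: "2 * card (hub ` X) + 2 \<le> card X"
      by (metis Suc_leI add_2_eq_Suc' dvd_triv_left even_Suc le_neq_implies_less not_less_eq_eq le_antisym)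
    obtain v where v: "v \<in> X" using X(2) by blast
    have "card (hub ` (X - {v, m v})) \<le> card (hub ` X)" using finX by (intro card_mono) auto
    with P_smaller[OF v] notP[OF v] gt hub_pos show False by linarith
  qed
  have ge: "2 \<le> card {w\<in>X. hub w = hub v}" if v: "v \<in> X" for v
  proof (rule ccontr)
    assume "\<not> ?thesis"
    then have "card {w\<in>X. hub w = hub v} \<le> 1" by simp
    then have single: "w = v" if "w \<in> X" "hub w = hub v" for w
      using that v finX card_le_Suc0_iff_eq[of "{w\<in>X. hub w = hub v}"] by auto
    have "hub ` (X - {v, m v}) \<subseteq> hub ` X - {hub v}" using single by auto
    then have "card (hub ` (X - {v, m v})) \<le> card (hub ` X) - 1"
      using card_mono[of "hub ` X - {hub v}"] finX v by simp
    moreover have "2 < card X"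
    proof -
      have mv: "m v \<in> X" "m v \<noteq> v" using X(3) v by (auto simp: pairing_def)
      then have "hub (m v) \<noteq> hub v" using single by blast
      then have "2 = card {hub v, hub (m v)}" by simp
      also have "\<dots> \<le> card (hub ` X)" using finX v mv by (intro card_mono) auto
      finally show ?thesis using eq by simp
    qed
    ultimately show False using P_smaller[OF v] notP[OF v] eq hub_pos by linarith
  qed
  have "card {w\<in>X. hub w = hub v} = 2" if v: "v \<in> X" for v
  proof (rule ccontr)
    assume "\<not> ?thesis"
    with ge[OF v] have gt: "2 < card {w\<in>X. hub w = hub v}" by simp
    have "card X = (\<Sum>x\<in>hub ` X. card {w\<in>X. hub w = x})"
      using finX by (subst card_eq_sum, subst sum.image_gen[of X _ hub]) auto
    also have "\<dots> > (\<Sum>x\<in>hub ` X. 2)"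
      using finX v gt ge by (intro sum_strict_mono_ex1) auto
    finally show False using eq by simp
  qed
  with X that show ?thesis by blast
qed

section \<open>Critical graphs\<close>

definition nbrs :: "('a \<times> 'a) set \<Rightarrow> 'a \<Rightarrow> 'a set" where
  "nbrs A x = {y. (x, y) \<in> A}"

definition near :: "('a \<times> 'a) set \<Rightarrow> 'a \<Rightarrow> 'a set" where
  "near A x = (nbrs A x \<union> \<Union>(nbrs A ` nbrs A x)) - {x}"

text \<open>
  The vertices of \<open>S\<close> count as uncoloured: they carry a value only because functions are total.
\<close>

definition colouring_off :: "('a \<times> 'a) set \<Rightarrow> nat \<Rightarrow> 'a set \<Rightarrow> ('a \<Rightarrow> nat) \<Rightarrow> bool" where
  "colouring_off A q S \<phi> \<longleftrightarrow>
     (\<forall>x. \<phi> x \<in> {1..q}) \<and> (\<forall>x y. x \<notin> S \<longrightarrow> y \<notin> S \<longrightarrow> y \<in> near A x \<longrightarrow> \<phi> x \<noteq> \<phi> y)"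

definition colourable_off :: "('a \<times> 'a) set \<Rightarrow> nat \<Rightarrow> 'a set \<Rightarrow> bool" where
  "colourable_off A q S \<longleftrightarrow> (\<exists>\<phi>. colouring_off A q S \<phi>)"

text \<open>
  A counterexample with the fewest arcs. The number \<open>k\<close> is only an upper bound for the degrees, so that
  the property passes to subgraphs.
\<close>

locale critical_graph =
  fixes A :: "('a \<times> 'a) set" and k :: nat
  assumes finite_arcs: "finite A"
    and sym_arcs: "sym A"
    and irrefl_arcs: "irrefl A"
    and degree_le: "card (nbrs A x) \<le> k"
    and k_ge: "10 \<le> k"
    and not_colourable: "\<not> colourable_off A (k + 2) {}"
    and smaller_colourable: "A' \<subset> A \<Longrightarrow> sym A' \<Longrightarrow> colourable_off A' (k + 2) {}"
begin

abbreviation N where "N \<equiv> nbrs A"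
abbreviation d where "d x \<equiv> card (N x)"
abbreviation free where "free S \<equiv> colourable_off A (k + 2) S"

lemma nbr_sym: "y \<in> N x \<longleftrightarrow> x \<in> N y"
  using sym_arcs by (auto simp: nbrs_def sym_def)

lemma nbr_irrefl: "x \<notin> N x"
  using irrefl_arcs by (auto simp: nbrs_def irrefl_def)

lemma finite_nbrs [simp]: "finite (N x)"
proof -
  have "N x \<subseteq> snd ` A" by (force simp: nbrs_def)
  then show ?thesis using finite_arcs finite_subset by blast
qed

lemma finite_near: "finite (near A x)"
  by (simp add: near_def)

lemma near_sym: "y \<in> near A x \<longleftrightarrow> x \<in> near A y"
  using nbr_sym unfolding near_def by blast

text \<open>
  Deleting the edge \<open>uv\<close> destroys only adjacencies and paths of length two that have \<open>u\<close> or \<open>v\<close> as an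
  end. A colouring of the smaller graph is therefore correct wherever \<open>u\<close> and \<open>v\<close> are not involved.
\<close>

lemma free_of_edge:
  assumes "v \<in> N u" "u \<in> S" "v \<in> S"
  shows "free S"
proof -
  let ?A' = "A - {(u, v), (v, u)}"
  have "?A' \<subset> A" "sym ?A'" using assms(1) sym_arcs by (auto simp: nbrs_def sym_def)
  then obtain \<phi> where \<phi>: "colouring_off ?A' (k + 2) {} \<phi>"
    using smaller_colourable by (auto simp: colourable_off_def)
  have "y \<in> near ?A' x" if "x \<notin> S" "y \<notin> S" "y \<in> near A x" for x y
    using that assms by (auto simp: near_def nbrs_def)
  then have "colouring_off A (k + 2) S \<phi>"
    using \<phi> by (auto simp: colouring_off_def)
  then show ?thesis by (auto simp: colourable_off_def)
qed

text \<open>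
  At a leaf the second end of the deleted edge need not be uncoloured, since every destroyed path ends in
  the leaf.
\<close>

lemma free_of_leaf:
  assumes "N v = {u}"
  shows "free {v}"
proof -
  let ?A' = "A - {(u, v), (v, u)}"
  have uv: "(v, y) \<in> A \<longleftrightarrow> y = u" "(y, v) \<in> A \<longleftrightarrow> y = u" for y
    using assms nbr_sym by (auto simp: nbrs_def)
  then have "?A' \<subset> A" "sym ?A'" using sym_arcs by (auto simp: sym_def)
  then obtain \<phi> where \<phi>: "colouring_off ?A' (k + 2) {} \<phi>"
    using smaller_colourable by (auto simp: colourable_off_def)
  have "y \<in> near ?A' x" if "x \<noteq> v" "y \<noteq> v" "y \<in> near A x" for x y
    using that uv by (auto simp: near_def nbrs_def)
  then have "colouring_off A (k + 2) {v} \<phi>"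
    using \<phi> by (auto simp: colouring_off_def)
  then show ?thesis by (auto simp: colourable_off_def)
qed

lemma recolour:
  assumes \<phi>: "colouring_off A (k + 2) S \<phi>"
    and lists: "\<And>v. v \<in> F \<Longrightarrow> \<psi> v \<in> {1..k + 2} - \<phi> ` (near A v - S)"
    and proper: "\<And>v w. v \<in> F \<Longrightarrow> w \<in> F \<Longrightarrow> w \<in> near A v \<Longrightarrow> \<psi> v \<noteq> \<psi> w"
  shows "colouring_off A (k + 2) (S - F) (\<lambda>x. if x \<in> F then \<psi> x else \<phi> x)"
  unfolding colouring_off_def
proof (intro conjI allI impI)
  fix x show "(if x \<in> F then \<psi> x else \<phi> x) \<in> {1..k + 2}"
    using \<phi> lists by (auto simp: colouring_off_def)
next
  fix x y assume xy: "x \<notin> S - F" "y \<notin> S - F" "y \<in> near A x"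
  have "\<psi> v \<noteq> \<phi> w" if "v \<in> F" "w \<notin> S" "w \<in> near A v" for v w
    using lists[OF that(1)] that(2,3) by blast
  then show "(if x \<in> F then \<psi> x else \<phi> x) \<noteq> (if y \<in> F then \<psi> y else \<phi> y)"
    using xy proper \<phi> near_sym unfolding colouring_off_def by (smt (verit) DiffI)
qed

lemma list_size:
  assumes "card (near A v - S) + n \<le> k + 2"
  shows "n \<le> card ({1..k + 2} - \<phi> ` (near A v - S))"
proof -
  have "card (\<phi> ` (near A v - S)) \<le> card (near A v - S)"
    using finite_near by (intro card_image_le) auto
  moreover have "card {1..k + 2} - card (\<phi> ` (near A v - S)) \<le> card ({1..k + 2} - \<phi> ` (near A v - S))"
    using finite_near by (intro diff_card_le_card_Diff) auto
  ultimately show ?thesis using assms by simp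
qed

lemma greedy:
  assumes "free S" "card (near A v - S) \<le> k + 1"
  shows "free (S - {v})"
proof -
  obtain \<phi> where \<phi>: "colouring_off A (k + 2) S \<phi>" using assms(1) by (auto simp: colourable_off_def)
  have "1 \<le> card ({1..k + 2} - \<phi> ` (near A v - S))"
    using assms(2) by (intro list_size) simp
  then obtain c where "c \<in> {1..k + 2} - \<phi> ` (near A v - S)"
    by (metis card.empty ex_in_conv not_one_le_zero)
  then have "colouring_off A (k + 2) (S - {v}) (\<lambda>x. if x \<in> {v} then c else \<phi> x)"
    by (intro recolour[OF \<phi>]) (auto simp: near_def)
  then show ?thesis by (auto simp: colourable_off_def)
qed

text \<open>
  An upper bound for the number of coloured vertices that \<open>v\<close> sees through its neighbour \<open>z\<close>, with
  \<open>z\<close> itself included.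
\<close>

definition cost :: "'a set \<Rightarrow> 'a \<Rightarrow> 'a \<Rightarrow> nat" where
  "cost S v z = card (insert z (N z - {v}) - S)"

lemma near_le_cost: "card (near A v - S) \<le> (\<Sum>z\<in>N v. cost S v z)"
proof -
  have "near A v - S \<subseteq> (\<Union>z\<in>N v. insert z (N z - {v}) - S)"
    by (auto simp: near_def)
  then have "card (near A v - S) \<le> card (\<Union>z\<in>N v. insert z (N z - {v}) - S)"
    by (intro card_mono) auto
  also have "\<dots> \<le> (\<Sum>z\<in>N v. cost S v z)"
    unfolding cost_def by (intro card_UN_le) simp
  finally show ?thesis .
qed

lemma cost_le:
  assumes "z \<in> N v"
  shows "cost S v z \<le> d z"
proof -
  have "cost S v z \<le> card (insert z (N z - {v}))" unfolding cost_def by (intro card_mono) auto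
  also have "\<dots> \<le> Suc (card (N z - {v}))" by (rule card_insert_le_m1) auto
  also have "\<dots> = d z" using assms nbr_sym by (intro card_Suc_Diff1) auto
  finally show ?thesis .
qed

lemma cost_le_removed:
  assumes "z \<in> N v" "z \<in> S"
  shows "cost S v z \<le> d z - 1"
proof -
  have "cost S v z \<le> card (N z - {v})" unfolding cost_def using assms(2) by (intro card_mono) auto
  also have "\<dots> = d z - 1" using assms nbr_sym by (intro card_Diff_singleton) auto
  finally show ?thesis .
qed

lemma greedy_sum:
  assumes "free S" "(\<Sum>z\<in>N v. d z) \<le> k + 1"
  shows "free (S - {v})"
proof (rule greedy[OF assms(1)])
  have "(\<Sum>z\<in>N v. cost S v z) \<le> (\<Sum>z\<in>N v. d z)" by (intro sum_mono cost_le)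
  with near_le_cost[of v S] assms(2) show "card (near A v - S) \<le> k + 1" by linarith
qed

lemma greedy_set:
  assumes "finite U" "free (U \<union> S)" "\<And>v. v \<in> U \<Longrightarrow> (\<Sum>z\<in>N v. d z) \<le> k + 1" "U \<inter> S = {}"
  shows "free S"
  using assms
proof (induction U)
  case (insert v U)
  have "free (insert v U \<union> S - {v})" using insert.prems by (intro greedy_sum) auto
  moreover have "insert v U \<union> S - {v} = U \<union> S" using insert.prems insert.hyps by auto
  ultimately show ?case using insert by auto
qed simp

section \<open>Reducible configurations\<close>

lemma degree_ne_1: "d v \<noteq> 1"
proof
  assume "d v = 1"
  then obtain u where u: "N v = {u}" by (auto simp: card_1_singleton_iff)
  have "free ({v} - {v})"
    using free_of_leaf[OF u] degree_le[of u] by (intro greedy_sum) (auto simp: u)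
  with not_colourable show False by simp
qed

lemma degree2_nbrs:
  assumes "d v = 2" "u \<in> N v"
  obtains w where "N v = {u, w}" "u \<noteq> w"
proof -
  have "card (N v - {u}) = 1" using assms by simp
  then obtain w where "N v - {u} = {w}" by (auto simp: card_1_singleton_iff)
  then have "N v = {u, w}" "u \<noteq> w" using assms(2) by auto
  then show ?thesis using that by blast
qed

text \<open>
  With \<open>d u < k\<close>, uncolour both \<open>2\<close>-vertices. The one farther from \<open>u\<close> still sees at most \<open>k + 1\<close>
  coloured vertices, and afterwards the one at \<open>u\<close> sees at most \<open>d u + 2\<close>.
\<close>

lemma adjacent_2_vertices:
  assumes "d v = 2" "d v' = 2" "v' \<in> N v" "u \<in> N v" "u \<noteq> v'"
  shows "d u = k"
proof (rule ccontr)
  assume "d u \<noteq> k"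
  then have du: "d u \<le> k - 1" using degree_le[of u] by simp
  have Nv: "N v = {v', u}" using degree2_nbrs[OF assms(1,3)] assms(4,5) by blast
  obtain w where Nv': "N v' = {v, w}" "v \<noteq> w" using degree2_nbrs[OF assms(2)] assms(3) nbr_sym by metis
  have "free {v, v'}" using assms(3) by (intro free_of_edge[of v' v]) auto
  moreover have "card (near A v' - {v, v'}) \<le> k + 1"
  proof -
    have "cost {v, v'} v' v \<le> 1"
      using cost_le_removed[of v v' "{v, v'}"] Nv' assms(1) by simp
    moreover have "cost {v, v'} v' w \<le> k"
      using cost_le[of w v'] Nv' degree_le[of w] le_trans by blast
    ultimately show ?thesis
      using near_le_cost[of v' "{v, v'}"] Nv' by simp
  qed
  ultimately have "free ({v, v'} - {v'})" by (rule greedy)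
  moreover have "(\<Sum>z\<in>N v. d z) \<le> k + 1"
    using du k_ge assms(2,5) by (simp add: Nv)
  ultimately have "free ({v, v'} - {v'} - {v})" by (rule greedy_sum)
  moreover have "{v, v'} - {v'} - {v} = {}" by auto
  ultimately show False using not_colourable by simp
qed

text \<open>
  Such a vertex can be coloured after all others.
\<close>

definition light :: "'a \<Rightarrow> bool" where
  "light v \<longleftrightarrow> d v = 2 \<and> (\<Sum>z\<in>N v. d z) \<le> k + 1"

text \<open>
  Uncolour \<open>u\<close> and its light neighbours. The light neighbours can wait until the end, so the obstacle
  must be \<open>u\<close>. Through a light neighbour, \<open>u\<close> sees at most one
  coloured vertex.
\<close>

lemma light_nbr:
  assumes "v \<in> N u" "light v"
  shows "k + 2 \<le> (\<Sum>z\<in>N u. if light z then 1 else d z)"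
proof (rule ccontr)
  assume small: "\<not> ?thesis"
  define U where "U = {z\<in>N u. light z}"
  have "free (insert u U)" using assms by (intro free_of_edge[of v u]) (auto simp: U_def)
  moreover have "card (near A u - insert u U) \<le> k + 1"
  proof -
    have "(\<Sum>z\<in>N u. cost (insert u U) u z) \<le> (\<Sum>z\<in>N u. if light z then 1 else d z)"
    proof (intro sum_mono)
      fix z assume z: "z \<in> N u"
      show "cost (insert u U) u z \<le> (if light z then 1 else d z)"
        using cost_le[OF z] cost_le_removed[OF z, of "insert u U"] z
        by (auto simp: U_def light_def)
    qed
    with near_le_cost[of u "insert u U"] small show ?thesis by linarith
  qed
  ultimately have "free (insert u U - {u})" by (rule greedy)
  moreover have "insert u U - {u} = U \<union> {}" using nbr_irrefl by (auto simp: U_def)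
  ultimately have "free (U \<union> {})" by simp
  then have "free {}" by (rule greedy_set[rotated]) (auto simp: U_def light_def)
  with not_colourable show False by simp
qed

text \<open>
  With \<open>d w < k\<close>, uncolour \<open>u\<close>, \<open>v\<close> and \<open>v'\<close> and colour them again in the order \<open>v'\<close>, \<open>v\<close>, \<open>u\<close>. The
  saving at \<open>w\<close> makes up for the colour that \<open>v'\<close> takes away from \<open>v\<close>; at the end \<open>u\<close> sees at most
  \<open>2 + 2 + 7\<close> vertices, which is where \<open>k \<ge> 10\<close> enters.
\<close>

lemma two_2_vertices_at_3_vertex:
  assumes Nu: "N u = {v, v', z}" "v \<noteq> v'" "v \<noteq> z" "v' \<noteq> z"
    and "d v = 2" "d v' = 2" "d z \<le> 7" "w \<in> N v" "w \<noteq> u"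
  shows "d w = k"
proof (rule ccontr)
  assume "d w \<noteq> k"
  then have dw: "d w \<le> k - 1" using degree_le[of w] by simp
  have ne: "u \<noteq> v" "u \<noteq> v'" "u \<noteq> z" using Nu nbr_irrefl by blast+
  have "u \<in> N v" "u \<in> N v'" using Nu nbr_sym by auto
  then have Nv: "N v = {u, w}" using degree2_nbrs[OF assms(5), of u] assms(8,9) by blast
  obtain w' where Nv': "N v' = {u, w'}" "u \<noteq> w'" using degree2_nbrs[OF assms(6) \<open>u \<in> N v'\<close>] .
  let ?S = "{u, v, v'}"
  have "free ?S" using Nu by (intro free_of_edge[of v u]) auto
  moreover have "card (near A v' - ?S) \<le> k + 1"
  proof -
    have "cost ?S v' u \<le> card {z}" unfolding cost_def using Nu by (intro card_mono) auto
    moreover have "cost ?S v' w' \<le> k"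
      using cost_le[of w' v'] Nv' degree_le[of w'] le_trans by blast
    ultimately show ?thesis using near_le_cost[of v' ?S] Nv' by simp
  qed
  ultimately have "free (?S - {v'})" by (rule greedy)
  moreover have "card (near A v - (?S - {v'})) \<le> k + 1"
  proof -
    have "cost (?S - {v'}) v u \<le> card {v', z}" unfolding cost_def using Nu by (intro card_mono) auto
    also have "\<dots> \<le> 2" by (simp add: card_insert_if)
    finally have "cost (?S - {v'}) v u \<le> 2" .
    moreover have "cost (?S - {v'}) v w \<le> k - 1"
      using cost_le[of w v] Nv dw le_trans by blast
    ultimately show ?thesis using near_le_cost[of v "?S - {v'}"] Nv assms(9) k_ge by simp
  qed
  ultimately have "free (?S - {v'} - {v})" by (rule greedy)
  moreover have "(\<Sum>z\<in>N u. d z) \<le> k + 1"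
    using Nu assms(5-7) k_ge by simp
  ultimately have "free (?S - {v'} - {v} - {u})" by (rule greedy_sum)
  moreover have "?S - {v'} - {v} - {u} = {}" by auto
  ultimately show False using not_colourable by simp
qed

section \<open>Cycles through vertices of maximum degree\<close>

definition in_pair :: "'a \<Rightarrow> bool" where
  "in_pair v \<longleftrightarrow> d v = 2 \<and> (\<exists>y\<in>N v. d y = 2)"

definition tripod :: "'a \<Rightarrow> bool" where
  "tripod u \<longleftrightarrow> d u = 3 \<and> (\<forall>v\<in>N u. d v = 2)"

text \<open>
  The \<open>2\<close>-vertices by which a connection (two adjacent \<open>2\<close>-vertices, or a tripod) is attached to a
  vertex of degree \<open>k\<close>, its hub. The other neighbour belongs to the connection and is called \<open>mid\<close>; it
  has degree \<open>2\<close> or \<open>3\<close>, so it cannot be confused with the hub.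
\<close>

definition foot :: "'a \<Rightarrow> bool" where
  "foot v \<longleftrightarrow> (\<exists>m x. N v = {m, x} \<and> m \<noteq> x \<and> d x = k \<and> (d m = 2 \<or> tripod m))"

definition hub :: "'a \<Rightarrow> 'a" where
  "hub v = (THE x. x \<in> N v \<and> d x = k)"

definition mid :: "'a \<Rightarrow> 'a" where
  "mid v = (THE m. m \<in> N v \<and> d m \<noteq> k)"

lemma footI:
  assumes "N v = {m, x}" "m \<noteq> x" "d x = k" "d m = 2 \<or> tripod m"
  shows "foot v" "mid v = m" "hub v = x"
proof -
  have "d m \<noteq> k" using assms(4) k_ge by (auto simp: tripod_def)
  then show "mid v = m" "hub v = x" using assms(1-3) unfolding mid_def hub_def by (auto intro!: the_equality)
  show "foot v" using assms unfolding foot_def by blast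
qed

lemma footD:
  assumes "foot v"
  shows "N v = {mid v, hub v}" "mid v \<noteq> hub v" "d (hub v) = k" "d (mid v) = 2 \<or> tripod (mid v)"
    "d v = 2" "mid v \<in> N v" "hub v \<in> N v" "v \<in> N (mid v)" "v \<in> N (hub v)"
    "d (mid v) = 2 \<or> d (mid v) = 3"
proof -
  obtain m x where mx: "N v = {m, x}" "m \<noteq> x" "d x = k" "d m = 2 \<or> tripod m"
    using assms by (auto simp: foot_def)
  note eq = footI(2,3)[OF mx]
  show "N v = {mid v, hub v}" "mid v \<noteq> hub v" "d (hub v) = k" "d (mid v) = 2 \<or> tripod (mid v)"
    using mx eq by simp_all
  then show "d v = 2" "mid v \<in> N v" "hub v \<in> N v" "d (mid v) = 2 \<or> d (mid v) = 3"
    by (auto simp: tripod_def)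
  then show "v \<in> N (mid v)" "v \<in> N (hub v)" using nbr_sym by blast+
qed

lemma pair_foot:
  assumes "d v = 2" "y \<in> N v" "d y = 2"
  shows "foot v" "mid v = y"
proof -
  obtain x where x: "N v = {y, x}" "y \<noteq> x" using degree2_nbrs[OF assms(1,2)] .
  then have "d x = k" using adjacent_2_vertices[OF assms(1,3,2)] by auto
  with footI[OF x] assms(3) show "foot v" "mid v = y" by auto
qed

lemma tripod_foot:
  assumes "tripod u" "v \<in> N u"
  shows "foot v" "mid v = u"
proof -
  have dv: "d v = 2" and "d u = 3" using assms by (auto simp: tripod_def)
  then have "card (N u - {v}) = 2" using assms(2) by simp
  then obtain v' z where vz: "N u - {v} = {v', z}" "v' \<noteq> z" by (auto simp: card_2_iff)
  then have Nu: "N u = {v, v', z}" "v \<noteq> v'" "v \<noteq> z" using assms(2) by auto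
  then have "d v' = 2" "d z \<le> 7" using assms(1) by (auto simp: tripod_def)
  obtain x where x: "N v = {u, x}" "u \<noteq> x" using degree2_nbrs[OF dv] assms(2) nbr_sym by metis
  then have "d x = k"
    using two_2_vertices_at_3_vertex[OF Nu vz(2) dv \<open>d v' = 2\<close> \<open>d z \<le> 7\<close>] by auto
  with footI[OF x] assms(1) show "foot v" "mid v = u" by auto
qed

text \<open>
  The involution \<open>\<sigma>\<close> exchanges the two chosen feet of a connection, and \<open>\<tau>\<close> the two chosen feet at a
  hub. Uncolour the chosen feet and the centres of the tripods. A foot then sees at most \<open>k\<close> coloured
  vertices: at its hub all but two feet are coloured, which leaves \<open>k - 1\<close> vertices, and through its
  connection it sees one more, namely the opposite hub or the third foot of the tripod. So it has two
  colours left, and it is in conflict with no uncoloured feet but its images under \<open>\<sigma>\<close> and \<open>\<tau>\<close>. The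
  centres of the tripods see at most six vertices and are coloured last.
\<close>

lemma no_two_regular_feet:
  assumes F: "finite F" "F \<noteq> {}" "\<And>v. v \<in> F \<Longrightarrow> foot v"
    and \<sigma>: "pairing F \<sigma>"
    and \<sigma>_pair: "\<And>v. v \<in> F \<Longrightarrow> d (mid v) = 2 \<Longrightarrow> \<sigma> v = mid v"
    and \<sigma>_tripod: "\<And>v w. v \<in> F \<Longrightarrow> w \<in> F \<Longrightarrow> mid w = mid v \<Longrightarrow> tripod (mid v) \<Longrightarrow> w \<in> {v, \<sigma> v}"
      "\<And>v. v \<in> F \<Longrightarrow> tripod (mid v) \<Longrightarrow> mid (\<sigma> v) = mid v"
    and regular: "\<And>v. v \<in> F \<Longrightarrow> card {w\<in>F. hub w = hub v} = 2"
  shows False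
proof -
  define \<tau> where "\<tau> v = (THE w. w \<in> F \<and> hub w = hub v \<and> w \<noteq> v)" for v
  have \<tau>: "\<tau> v \<in> F \<and> hub (\<tau> v) = hub v \<and> \<tau> v \<noteq> v"
    and \<tau>_unique: "\<And>w. w \<in> F \<Longrightarrow> hub w = hub v \<Longrightarrow> w \<noteq> v \<Longrightarrow> w = \<tau> v" if v: "v \<in> F" for v
  proof -
    have "card ({w\<in>F. hub w = hub v} - {v}) = 1" using regular[OF v] v F(1) by simp
    then obtain t where t: "{w\<in>F. hub w = hub v} - {v} = {t}" by (auto simp: card_1_singleton_iff)
    then have *: "w \<in> F \<and> hub w = hub v \<and> w \<noteq> v \<longleftrightarrow> w = t" for w by blast
    have "\<tau> v = t" unfolding \<tau>_def * by simp
    with * show "\<tau> v \<in> F \<and> hub (\<tau> v) = hub v \<and> \<tau> v \<noteq> v"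
      "\<And>w. w \<in> F \<Longrightarrow> hub w = hub v \<Longrightarrow> w \<noteq> v \<Longrightarrow> w = \<tau> v" by metis+
  qed
  have "pairing F \<tau>"
    unfolding pairing_def
  proof
    fix v assume v: "v \<in> F"
    note t = \<tau>[OF v]
    show "\<tau> v \<in> F \<and> \<tau> (\<tau> v) = v \<and> \<tau> v \<noteq> v"
      using t \<tau>_unique[of "\<tau> v" v] v by metis
  qed
  have \<sigma>F: "\<sigma> v \<in> F" "\<sigma> v \<noteq> v" if "v \<in> F" for v using \<sigma> that by (auto simp: pairing_def)
  \<comment> \<open>For adjacent \<open>2\<close>-vertices \<open>mid v\<close> is again a foot, so that only centres of tripods are added.\<close>
  define S where "S = F \<union> mid ` F"
  have small: "card (near A v - S) + 2 \<le> k + 2" if v: "v \<in> F" for v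
  proof -
    note f = footD[OF F(3)[OF v]]
    have "cost S v (mid v) \<le> 1"
    proof (cases "d (mid v) = 2")
      case True
      then show ?thesis using cost_le_removed[OF f(6), of S] v by (simp add: S_def)
    next
      case False
      then have tri: "tripod (mid v)" using f(4) by blast
      have s: "\<sigma> v \<in> N (mid v)"
        using footD(8)[OF F(3)[OF \<sigma>F(1)[OF v]]] \<sigma>_tripod(2)[OF v tri] by simp
      have "cost S v (mid v) \<le> card (N (mid v) - {v, \<sigma> v})"
        unfolding cost_def using v \<sigma>F(1)[OF v] by (intro card_mono) (auto simp: S_def)
      also have "\<dots> = 1"
        using s f(8) \<sigma>F(2)[OF v] tri by (subst card_Diff_subset) (auto simp: tripod_def)
      finally show ?thesis .
    qed
    moreover have "cost S v (hub v) \<le> k - 1"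
    proof -
      have t: "\<tau> v \<in> N (hub v)" using footD(9)[OF F(3), of "\<tau> v"] \<tau>[OF v] by simp
      have "cost S v (hub v) \<le> card (insert (hub v) (N (hub v) - {v, \<tau> v}))"
        unfolding cost_def using v \<tau>[OF v] by (intro card_mono) (auto simp: S_def)
      also have "\<dots> \<le> Suc (card (N (hub v) - {v, \<tau> v}))" by (rule card_insert_le_m1) auto
      also have "card (N (hub v) - {v, \<tau> v}) = k - 2"
        using t f(3,9) \<tau>[OF v] by (subst card_Diff_subset) auto
      finally show ?thesis using k_ge by simp
    qed
    ultimately have "(\<Sum>z\<in>N v. cost S v z) \<le> k"
      unfolding f(1) using f(2) k_ge by simp
    then show ?thesis using near_le_cost[of v S] by simp
  qed
  have conflicts: "w = \<sigma> v \<or> w = \<tau> v" if v: "v \<in> F" and w: "w \<in> F" "w \<in> near A v" for v w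
  proof -
    note f = footD[OF F(3)[OF v]] and g = footD[OF F(3)[OF w(1)]]
    have dw: "d w \<noteq> k" "d w \<noteq> 3" "d w = 2" using g(5) k_ge by auto
    have "w \<noteq> v" using w(2) by (auto simp: near_def)
    consider "w \<in> N v" | "w \<in> N (hub v)" | "w \<in> N (mid v)"
      using w(2) f(1) by (auto simp: near_def)
    then show ?thesis
    proof cases
      case 1
      then have "w = mid v" using f(1,3) dw by auto
      then show ?thesis using \<sigma>_pair[OF v] dw by simp
    next
      case 2
      then have "hub v \<in> N w" using nbr_sym by blast
      then have "hub v = hub w" using g(1,10) f(3) k_ge by auto
      then show ?thesis using \<tau>_unique[OF v w(1)] \<open>w \<noteq> v\<close> by simp
    next
      case 3
      then have m: "mid v \<in> N w" using nbr_sym by blast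
      then have mw: "mid v = mid w" using g(1,3) f(10) k_ge by auto
      show ?thesis
      proof (cases "d (mid v) = 2")
        case True
        obtain x where x: "N (mid v) = {v, x}" "v \<noteq> x" using degree2_nbrs[OF True f(8)] .
        then have "x = w" using 3 \<open>w \<noteq> v\<close> by blast
        have "d x = k" using adjacent_2_vertices[OF True f(5) f(8), of x] x by auto
        with \<open>x = w\<close> dw show ?thesis by simp
      next
        case False
        then have "tripod (mid v)" using f(4) by blast
        then show ?thesis using \<sigma>_tripod(1)[OF v w(1)] mw \<open>w \<noteq> v\<close> by simp
      qed
    qed
  qed
  obtain v0 where v0: "v0 \<in> F" using F(2) by blast
  have "free S"
    using footD(6)[OF F(3)[OF v0]] v0 by (intro free_of_edge[of "mid v0" v0]) (auto simp: S_def)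
  then obtain \<phi> where \<phi>: "colouring_off A (k + 2) S \<phi>" by (auto simp: colourable_off_def)
  obtain \<psi> where \<psi>: "\<And>v. v \<in> F \<Longrightarrow>
      \<psi> v \<in> {1..k + 2} - \<phi> ` (near A v - S) \<and> \<psi> v \<noteq> \<psi> (\<sigma> v) \<and> \<psi> v \<noteq> \<psi> (\<tau> v)"
    using two_pairings_choosable[OF F(1) \<sigma> \<open>pairing F \<tau>\<close>,
        of "\<lambda>v. {1..k + 2} - \<phi> ` (near A v - S)"] list_size[OF small] by metis
  have "colouring_off A (k + 2) (S - F) (\<lambda>x. if x \<in> F then \<psi> x else \<phi> x)"
    using \<psi> conflicts by (intro recolour[OF \<phi>]) blast+
  then have "free ((S - F) \<union> {})" by (auto simp: colourable_off_def)
  moreover have "(\<Sum>z\<in>N u. d z) \<le> k + 1" if u: "u \<in> S - F" for u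
  proof -
    obtain v where v: "v \<in> F" "u = mid v" using u by (auto simp: S_def)
    have "d (mid v) \<noteq> 2" using u v \<sigma>_pair[OF v(1)] \<sigma>F(1)[OF v(1)] by auto
    then have "tripod u" using footD(4)[OF F(3)[OF v(1)]] v(2) by simp
    then show ?thesis using k_ge by (simp add: tripod_def)
  qed
  ultimately have "free {}" by (rule greedy_set[rotated]) (use F(1) in \<open>auto simp: S_def\<close>)
  with not_colourable show False by simp
qed

lemma finite_degree_pos: "finite {x. P x \<and> 0 < d x}"
proof -
  have "{x. P x \<and> 0 < d x} \<subseteq> fst ` A" by (force simp: nbrs_def card_gt_0_iff)
  then show ?thesis using finite_arcs finite_subset by blast
qed

text \<open>
  Choosing two feet of every connection yields a multigraph on the vertices of degree \<open>k\<close>. It has no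
  \<open>2\<close>-regular subgraph, so it has at most as many edges as vertices. Adjacent \<open>2\<close>-vertices
  contribute both of their feet to the count on the left, a tripod contributes its centre, in place of
  one of its two chosen feet.
\<close>

lemma connectors_le_hubs:
  "card {v. in_pair v} + card {u. tripod u} \<le> 2 * card {x. d x = k}"
proof -
  define a where "a u = (SOME x. x \<in> N u)" for u
  define b where "b u = (SOME y. y \<in> N u \<and> y \<noteq> a u)" for u
  have ab: "a u \<in> N u \<and> b u \<in> N u \<and> a u \<noteq> b u" if t: "tripod u" for u
  proof -
    have two: "2 \<le> card (N u)" using t by (simp add: tripod_def)
    then obtain x y where "x \<in> N u" "y \<in> N u" "y \<noteq> a u" using other_element[OF two] by metis
    then show ?thesis
      using someI[of "\<lambda>x. x \<in> N u" x] someI[of "\<lambda>y. y \<in> N u \<and> y \<noteq> a u" y]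
      unfolding a_def[symmetric] b_def[symmetric] by metis
  qed
  define F where "F = {v. foot v \<and> (tripod (mid v) \<longrightarrow> v = a (mid v) \<or> v = b (mid v))}"
  define \<sigma> where "\<sigma> v = (if d (mid v) = 2 then mid v else if v = a (mid v) then b (mid v) else a (mid v))" for v
  have foot: "foot v" if "v \<in> F" for v using that by (simp add: F_def)
  have "F \<subseteq> {v. True \<and> 0 < d v}" using footD(5)[OF foot] by fastforce
  then have finF: "finite F" by (rule finite_subset[OF _ finite_degree_pos])
  have tri: "a u \<in> F" "b u \<in> F" "mid (a u) = u" "mid (b u) = u" if "tripod u" for u
    using tripod_foot[OF that] ab[OF that] by (auto simp: F_def)
  have mid_pair: "mid v \<in> F" "mid (mid v) = v" "d v = 2" if "v \<in> F" "d (mid v) = 2" for v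
  proof -
    note f = footD[OF foot[OF that(1)]]
    show "d v = 2" by fact
    show "mid (mid v) = v" "mid v \<in> F"
      using pair_foot[OF that(2) f(8,5)] f(5) by (auto simp: F_def tripod_def)
  qed
  have \<sigma>: "\<sigma> v \<in> F \<and> \<sigma> (\<sigma> v) = v \<and> \<sigma> v \<noteq> v" if v: "v \<in> F" for v
  proof (cases "d (mid v) = 2")
    case True
    then show ?thesis using mid_pair[OF v True] footD(6)[OF foot[OF v]] nbr_irrefl
      by (auto simp: \<sigma>_def)
  next
    case False
    then have t: "tripod (mid v)" using footD(4)[OF foot[OF v]] by blast
    then have "v = a (mid v) \<or> v = b (mid v)" using v by (simp add: F_def)
    then have "\<sigma> v \<in> F \<and> mid (\<sigma> v) = mid v \<and> \<sigma> v \<noteq> v \<and> (v = a (mid v) \<longleftrightarrow> \<sigma> v \<noteq> a (mid v))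
        \<and> (\<sigma> v = a (mid v) \<longrightarrow> v = b (mid v))"
      using tri[OF t] ab[OF t] False by (auto simp: \<sigma>_def)
    then show ?thesis using False by (auto simp: \<sigma>_def[of "\<sigma> v"])
  qed
  have "card F \<le> 2 * card (hub ` F)"
  proof (rule ccontr)
    assume "\<not> ?thesis"
    then have many: "2 * card (hub ` F) \<le> card F" "F \<noteq> {}" by auto
    have paired: "pairing F \<sigma>" using \<sigma> by (simp add: pairing_def)
    obtain F' where F': "F' \<subseteq> F" "F' \<noteq> {}" "pairing F' \<sigma>"
      "\<forall>v\<in>F'. card {w\<in>F'. hub w = hub v} = 2"
      using two_regular_subset[OF finF many(2) paired many(1)] .
    show False
    proof (rule no_two_regular_feet[OF _ F'(2) _ F'(3) _ _ _ F'(4)[rule_format]])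
      show "finite F'" using F'(1) finF finite_subset by blast
      show "foot v" if "v \<in> F'" for v using that F'(1) foot by blast
      show "\<sigma> v = mid v" if "d (mid v) = 2" for v using that by (simp add: \<sigma>_def)
      show "mid (\<sigma> v) = mid v" if "tripod (mid v)" for v
        using tri[OF that] that by (auto simp: \<sigma>_def tripod_def)
      show "w \<in> {v, \<sigma> v}" if "v \<in> F'" "w \<in> F'" "mid w = mid v" "tripod (mid v)" for v w
      proof -
        have "v \<in> F" "w \<in> F" using that F'(1) by blast+
        then have "v \<in> {a (mid v), b (mid v)}" "w \<in> {a (mid v), b (mid v)}"
          using that(3,4) by (auto simp: F_def)
        then show ?thesis using that(4) ab[OF that(4)] by (auto simp: \<sigma>_def tripod_def)
      qed
    qed
  qed
  also have "\<dots> \<le> 2 * card {x. d x = k}"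
  proof -
    have "{x. d x = k} = {x. d x = k \<and> 0 < d x}" using k_ge by auto
    then have "finite {x. d x = k}" using finite_degree_pos[of "\<lambda>x. d x = k"] by simp
    then have "card (hub ` F) \<le> card {x. d x = k}"
      using footD(3)[OF foot] by (intro card_mono) auto
    then show ?thesis by simp
  qed
  finally have *: "card F \<le> 2 * card {x. d x = k}" .
  \<comment> \<open>The centre of a tripod is counted through its first chosen foot.\<close>
  have "inj_on a {u. tripod u}" by (rule inj_on_inverseI[of _ mid]) (use tri in auto)
  then have "card {v. in_pair v} + card {u. tripod u} = card {v. in_pair v} + card (a ` {u. tripod u})"
    by (simp add: card_image)
  also have "\<dots> = card ({v. in_pair v} \<union> a ` {u. tripod u})"
  proof (intro card_Un_disjoint[symmetric])
    have "{v. in_pair v} = {v. in_pair v \<and> 0 < d v}" by (auto simp: in_pair_def)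
    then show "finite {v. in_pair v}" using finite_degree_pos[of in_pair] by simp
    have "a ` {u. tripod u} \<subseteq> F" using tri by auto
    then show "finite (a ` {u. tripod u})" using finF finite_subset by blast
    have "\<not> in_pair (a u)" if "tripod u" for u
    proof
      assume "in_pair (a u)"
      then obtain y where "y \<in> N (a u)" "d y = 2" "d (a u) = 2" by (auto simp: in_pair_def)
      then have "mid (a u) = y" using pair_foot by blast
      with tri[OF that] that \<open>d y = 2\<close> show False by (simp add: tripod_def)
    qed
    then show "{v. in_pair v} \<inter> a ` {u. tripod u} = {}" by auto
  qed
  also have "\<dots> \<le> card F"
  proof (intro card_mono finF)
    have "v \<in> F" if "in_pair v" for v
    proof -
      obtain y where "y \<in> N v" "d y = 2" "d v = 2" using \<open>in_pair v\<close> by (auto simp: in_pair_def)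
      then show ?thesis using pair_foot[of v y] by (auto simp: F_def tripod_def)
    qed
    then show "{v. in_pair v} \<union> a ` {u. tripod u} \<subseteq> F" using tri by auto
  qed
  finally show ?thesis using * by linarith
qed

section \<open>Discharging\<close>

text \<open>
  The charge that \<open>x\<close> sends to \<open>y\<close>. From degree \<open>5\<close> on, \<open>x\<close> sends the same amount to all neighbours; the
  thresholds are chosen such that \<open>10 d - 28\<close> suffices. Vertices of degree \<open>3\<close> and \<open>4\<close> support
  only \<open>2\<close>-vertices: a light one with half of its demand \<open>8\<close>, any other with what is missing after
  the other neighbour, which then has degree at least \<open>8\<close>, has sent \<open>6\<close> or \<open>7\<close>.
\<close>

definition give :: "'a \<Rightarrow> 'a \<Rightarrow> int" where
  "give x y =
     (if d x = k then 7 else if 8 \<le> d x then 6 else if 5 \<le> d x then 4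
      else if d x = 2 \<or> d y \<noteq> 2 then 0
      else if light y then 4
      else if \<exists>w\<in>N y. d w = k then 1 else 2)"

text \<open>
  The balance of each vertex with a common pot. Vertices of degree \<open>k\<close> pay \<open>2\<close> into it; each of two
  adjacent \<open>2\<close>-vertices takes the \<open>1\<close> that is missing after its neighbour of degree \<open>k\<close> has sent \<open>7\<close>,
  and a tripod takes the \<open>1\<close> that it is short of after serving three neighbours from its initial charge \<open>2\<close>.
\<close>

definition pot :: "'a \<Rightarrow> int" where
  "pot x = of_bool (in_pair x) + of_bool (tripod x) - 2 * of_bool (d x = k)"

abbreviation gain where "gain x y \<equiv> give y x - give x y"

lemma gain_of_small_vertex:
  assumes "d u = 3 \<or> d u = 4" "y \<in> N u"
  shows "light y \<Longrightarrow> gain u y = -4"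
    and "d y = 2 \<Longrightarrow> \<not> light y \<Longrightarrow> -2 \<le> gain u y"
    and "d y = 2 \<Longrightarrow> \<not> light y \<Longrightarrow> \<exists>w\<in>N y. d w = k \<Longrightarrow> gain u y = -1"
    and "3 \<le> d y \<Longrightarrow> 0 \<le> gain u y"
    and "5 \<le> d y \<Longrightarrow> 4 \<le> gain u y"
    and "8 \<le> d y \<Longrightarrow> 6 \<le> gain u y"
    and "d y = k \<Longrightarrow> gain u y = 7"
  using assms k_ge by (auto simp: give_def light_def)

lemma nbr_degree_ge_2:
  assumes "y \<in> N x"
  shows "2 \<le> d y"
proof -
  have "d y \<noteq> 0" using assms nbr_sym by (metis card_0_eq empty_iff finite_nbrs)
  then show ?thesis using degree_ne_1[of y] by linarith
qed

text \<open>
  A \<open>2\<close>-vertex needs \<open>8\<close>. If it is light or lies between vertices of degree at least \<open>5\<close>, both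
  neighbours send at least \<open>4\<close>. Otherwise the degrees of its neighbours add up to at least \<open>k + 2\<close>, so
  that a neighbour of degree \<open>3\<close> or \<open>4\<close> is balanced by one of degree at least \<open>8\<close>. A neighbour of
  degree \<open>2\<close> sends nothing; there \<open>7\<close> comes from the other side and \<open>1\<close> from the pot.
\<close>

lemma final_charge_2_vertex:
  assumes "d v = 2"
  shows "0 \<le> 10 * int (d v) - 28 + (\<Sum>y\<in>N v. gain v y) + pot v"
proof -
  obtain u w where uw: "N v = {u, w}" "u \<noteq> w" using assms by (auto simp: card_2_iff)
  have give0: "give v y = 0" for y using assms k_ge by (simp add: give_def)
  have sum: "(\<Sum>y\<in>N v. gain v y) = give u v + give w v" using uw give0 by simp
  have pot: "0 \<le> pot v" using assms k_ge by (simp add: pot_def)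
  have pair: "8 \<le> give u v + give w v + pot v" if "N v = {u, w}" "d u = 2" "u \<noteq> w" for u w
  proof -
    have "d w = k" using adjacent_2_vertices[OF assms that(2)] that by auto
    then have "give w v = 7" by (simp add: give_def)
    moreover have "give u v = 0" using that(2) k_ge by (simp add: give_def)
    moreover have "pot v = 1" using that assms k_ge by (auto simp: pot_def in_pair_def tripod_def)
    ultimately show ?thesis by simp
  qed
  have low: "8 \<le> give u v + give w v"
    if "N v = {u, w}" "u \<noteq> w" "3 \<le> d u" "d u \<le> 4" "\<not> light v" for u w
  proof -
    have "k + 2 \<le> d u + d w" using that assms by (simp add: light_def)
    then have "8 \<le> d w" using that k_ge by simp
    moreover have "d u \<noteq> k" using that k_ge by simp
    ultimately show ?thesis using that assms by (auto simp: give_def)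
  qed
  have "8 \<le> give u v + give w v + pot v"
  proof (cases "d u = 2 \<or> d w = 2")
    case True
    have "N v = {w, u}" using uw by auto
    with True pair[OF uw(1)] pair[of w u] uw show ?thesis by fastforce
  next
    case False
    then have deg: "3 \<le> d u" "3 \<le> d w" using nbr_degree_ge_2[of u v] nbr_degree_ge_2[of w v] uw by auto
    show ?thesis
    proof (cases "light v")
      case True
      then have "4 \<le> give u v" "4 \<le> give w v" using deg assms by (auto simp: give_def)
      with pot show ?thesis by simp
    next
      case light: False
      have "N v = {w, u}" using uw by auto
      consider "d u \<le> 4" | "d w \<le> 4" | "5 \<le> d u" "5 \<le> d w" by linarith
      then show ?thesis
      proof cases
        case 1
        then show ?thesis using low[OF uw deg(1) 1 light] pot by simp
      next
        case 2
        then show ?thesis using low[OF \<open>N v = {w, u}\<close> uw(2)[symmetric] deg(2) 2 light] pot by simp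
      next
        case 3
        then have "4 \<le> give u v" "4 \<le> give w v" by (auto simp: give_def)
        with pot show ?thesis by simp
      qed
    qed
  qed
  then show ?thesis using sum assms by simp
qed

lemma heavy_far_end:
  assumes "d u = 3" "v \<in> N u" "d v = 2" "v' \<in> N u" "v' \<noteq> v" "d v' = 2"
    "z \<in> N u" "z \<noteq> v" "z \<noteq> v'" "d z \<le> 7"
  shows "\<exists>w\<in>N v. d w = k"
proof -
  have Nu: "N u = {v, v', z}"
    using card_subset_eq[OF finite_nbrs, of "{v, v', z}" u] assms by auto
  obtain w where "N v = {u, w}" "u \<noteq> w" using degree2_nbrs[OF assms(3)] assms(2) nbr_sym by metis
  then show ?thesis using two_2_vertices_at_3_vertex[OF Nu] assms by auto
qed

text \<open>
  The number \<open>w\<close> is the contribution of \<open>y\<close> to the sum in \<open>light_nbr\<close>. Neighbours that cost charge have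
  small \<open>w\<close>, those that bring charge have large \<open>w\<close>.
\<close>

lemma gain_category:
  assumes "d u = 3" "y \<in> N u" "w = (if light y then 1 else d y)"
  shows "w = 1 \<and> gain u y = -4 \<or> w = 2 \<and> -2 \<le> gain u y \<or> 3 \<le> w \<and> w \<le> 4 \<and> 0 \<le> gain u y
    \<or> 5 \<le> w \<and> w \<le> 7 \<and> 4 \<le> gain u y \<or> 8 \<le> w \<and> w < k \<and> 6 \<le> gain u y \<or> w = k \<and> gain u y = 7"
proof (cases "light y")
  case True
  then show ?thesis using gain_of_small_vertex(1)[OF disjI1[OF assms(1)] assms(2)] assms(3) by simp
next
  case False
  note g = gain_of_small_vertex[OF disjI1[OF assms(1)] assms(2)]
  have "w = d y" using False assms(3) by simp
  moreover have "2 \<le> d y" "d y \<le> k" using nbr_degree_ge_2[OF assms(2)] degree_le[of y] by auto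
  then consider "d y = 2" | "3 \<le> d y" "d y \<le> 4" | "5 \<le> d y" "d y \<le> 7" | "8 \<le> d y" "d y < k" | "d y = k"
    by linarith
  then have "d y = 2 \<and> -2 \<le> gain u y \<or> 3 \<le> d y \<and> d y \<le> 4 \<and> 0 \<le> gain u y
    \<or> 5 \<le> d y \<and> d y \<le> 7 \<and> 4 \<le> gain u y \<or> 8 \<le> d y \<and> d y < k \<and> 6 \<le> gain u y \<or> d y = k \<and> gain u y = 7"
  proof cases
    case 1
    then show ?thesis using g(2) False by blast
  next
    case 2
    then show ?thesis using g(4) by blast
  next
    case 3
    then show ?thesis using g(5) by blast
  next
    case 4
    then show ?thesis using g(6) by blast
  next
    case 5
    then show ?thesis using g(7) by blast
  qed
  ultimately show ?thesis by blast
qed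

text \<open>
  A light neighbour forces the other two to have weights of sum at least \<open>k + 1\<close>, hence a neighbour of
  large degree that pays for the rest.
\<close>

lemma gains_with_light:
  assumes "d u = 3" "N u = {x, y, z}" "x \<noteq> y" "x \<noteq> z" "y \<noteq> z" "light x"
  shows "-2 \<le> gain u x + gain u y + gain u z"
proof -
  have inN: "x \<in> N u" "y \<in> N u" "z \<in> N u" using assms(2) by auto
  define wy where "wy = (if light y then 1 else d y)"
  define wz where "wz = (if light z then 1 else d z)"
  have "k + 2 \<le> (\<Sum>z\<in>N u. if light z then 1 else d z)" using light_nbr[OF inN(1) assms(6)] .
  also have "\<dots> = 1 + wy + wz" using assms(2-6) by (simp add: wy_def wz_def)
  finally have "k + 2 \<le> 1 + wy + wz" .
  moreover have "gain u x = -4" using gain_of_small_vertex(1)[OF disjI1[OF assms(1)] inN(1) assms(6)] .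
  moreover note gain_category[OF assms(1) inN(2) wy_def] gain_category[OF assms(1) inN(3) wz_def]
  ultimately show ?thesis using k_ge by (elim disjE conjE) linarith+
qed

text \<open>
  The critical case has two neighbours of degree \<open>2\<close> and a third one that sends nothing; then both
  \<open>2\<close>-vertices lead to vertices of degree \<open>k\<close> and ask for only \<open>1\<close> each.
\<close>

lemma gains_without_light:
  assumes "d u = 3" "N u = {x, y, z}" "x \<noteq> y" "x \<noteq> z" "y \<noteq> z"
    and "\<not> light x" "\<not> light y" "\<not> light z" "d z \<noteq> 2"
  shows "-2 \<le> gain u x + gain u y + gain u z"
proof -
  have inN: "x \<in> N u" "y \<in> N u" "z \<in> N u" using assms(2) by auto
  note gx = gain_of_small_vertex[OF disjI1[OF assms(1)] inN(1)]
    and gy = gain_of_small_vertex[OF disjI1[OF assms(1)] inN(2)]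
    and gz = gain_of_small_vertex[OF disjI1[OF assms(1)] inN(3)]
  have dz: "3 \<le> d z" using nbr_degree_ge_2[OF inN(3)] assms(9) by simp
  have lower: "-2 \<le> gain u x" "-2 \<le> gain u y"
    using gx(2,4) gy(2,4) assms(6,7) nbr_degree_ge_2[OF inN(1)] nbr_degree_ge_2[OF inN(2)] by force+
  consider "5 \<le> d z" | "d x \<noteq> 2" | "d y \<noteq> 2" | "d z \<le> 7" "d x = 2" "d y = 2" by linarith
  then show ?thesis
  proof cases
    case 1
    then show ?thesis using gz(5) lower by simp
  next
    case 2
    then have "3 \<le> d x" using nbr_degree_ge_2[OF inN(1)] by simp
    then show ?thesis using gx(4) gz(4)[OF dz] lower by simp
  next
    case 3
    then have "3 \<le> d y" using nbr_degree_ge_2[OF inN(2)] by simp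
    then show ?thesis using gy(4) gz(4)[OF dz] lower by simp
  next
    case 4
    have "\<exists>w\<in>N x. d w = k" "\<exists>w\<in>N y. d w = k"
      using heavy_far_end[OF assms(1) inN(1) 4(2) inN(2) _ 4(3) inN(3)]
        heavy_far_end[OF assms(1) inN(2) 4(3) inN(1) _ 4(2) inN(3)] 4(1) assms(3-5) by auto
    then show ?thesis using gx(3)[OF 4(2) assms(6)] gy(3)[OF 4(3) assms(7)] gz(4)[OF dz] by simp
  qed
qed

lemma gains_tripod:
  assumes "tripod u" "y \<in> N u"
  shows "-1 \<le> gain u y"
proof -
  have u: "d u = 3" and y: "d y = 2" using assms by (auto simp: tripod_def)
  have "hub y \<in> N y" "d (hub y) = k" using footD[OF tripod_foot(1)[OF assms]] by auto
  moreover have "\<not> light y"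
  proof
    assume "light y"
    then have "k + 2 \<le> (\<Sum>z\<in>N u. if light z then 1 else d z)" using light_nbr assms(2) by blast
    also have "\<dots> \<le> (\<Sum>z\<in>N u. 2)" using assms(1) by (intro sum_mono) (auto simp: tripod_def)
    finally show False using u k_ge by simp
  qed
  ultimately show ?thesis using gain_of_small_vertex(3)[OF disjI1[OF u] assms(2) y] by force
qed

lemma final_charge_3_vertex:
  assumes "d u = 3"
  shows "0 \<le> 10 * int (d u) - 28 + (\<Sum>y\<in>N u. gain u y) + pot u"
proof (cases "tripod u")
  case True
  then have "pot u = 1" using assms k_ge by (simp add: pot_def in_pair_def)
  moreover have "(\<Sum>y\<in>N u. -1) \<le> (\<Sum>y\<in>N u. gain u y)" using gains_tripod[OF True] by (intro sum_mono)
  ultimately show ?thesis using assms by simp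
next
  case False
  then have pot: "pot u = 0" using assms k_ge by (simp add: pot_def in_pair_def)
  have "\<exists>x y z. N u = {x, y, z} \<and> x \<noteq> y \<and> x \<noteq> z \<and> y \<noteq> z \<and> -2 \<le> gain u x + gain u y + gain u z"
  proof (cases "\<exists>x\<in>N u. light x")
    case True
    then obtain x where x: "x \<in> N u" "light x" by blast
    then have "card (N u - {x}) = 2" using assms by simp
    then obtain y z where "N u - {x} = {y, z}" "y \<noteq> z" by (auto simp: card_2_iff)
    then have *: "N u = {x, y, z}" "x \<noteq> y" "x \<noteq> z" "y \<noteq> z" using x(1) by auto
    show ?thesis using * gains_with_light[OF assms * x(2)] by blast
  next
    case no_light: False
    obtain z where z: "z \<in> N u" "d z \<noteq> 2" using False assms by (auto simp: tripod_def)
    then have "card (N u - {z}) = 2" using assms by simp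
    then obtain x y where "N u - {z} = {x, y}" "x \<noteq> y" by (auto simp: card_2_iff)
    then have *: "N u = {x, y, z}" "x \<noteq> y" "x \<noteq> z" "y \<noteq> z" using z(1) by auto
    show ?thesis using * gains_without_light[OF assms * _ _ _ z(2)] no_light by blast
  qed
  then obtain x y z where "N u = {x, y, z}" "x \<noteq> y" "x \<noteq> z" "y \<noteq> z"
    "-2 \<le> gain u x + gain u y + gain u z" by blast
  then have "-2 \<le> (\<Sum>y\<in>N u. gain u y)" by (simp add: add.assoc)
  then show ?thesis using assms pot by simp
qed

text \<open>
  The initial charge \<open>12\<close> pays for three light neighbours. Four neighbours of degree \<open>2\<close> cannot include a
  light one, because the weights in \<open>light_nbr\<close> would add up to at most \<open>8\<close>; and four others cost at most
  \<open>8\<close>.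
\<close>

lemma final_charge_4_vertex:
  assumes "d u = 4"
  shows "0 \<le> 10 * int (d u) - 28 + (\<Sum>y\<in>N u. gain u y) + pot u"
proof -
  have pot: "0 \<le> pot u" using assms k_ge by (simp add: pot_def)
  note g = gain_of_small_vertex[OF disjI2[OF assms]]
  have "-12 \<le> (\<Sum>y\<in>N u. gain u y)"
  proof (cases "\<exists>y\<in>N u. light y")
    case True
    then have "k + 2 \<le> (\<Sum>z\<in>N u. if light z then 1 else d z)" using light_nbr by blast
    moreover have "(\<Sum>z\<in>N u. if light z then 1 else d z) \<le> (\<Sum>z\<in>N u. 2)" if "\<forall>z\<in>N u. d z = 2"
      using that by (intro sum_mono) auto
    ultimately obtain z where z: "z \<in> N u" "d z \<noteq> 2" using k_ge assms by fastforce
    then have "0 \<le> gain u z" using g(4)[OF z(1)] nbr_degree_ge_2[OF z(1)] by simp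
    moreover have "(\<Sum>y\<in>N u - {z}. -4) \<le> (\<Sum>y\<in>N u - {z}. gain u y)"
    proof (intro sum_mono)
      fix y assume "y \<in> N u - {z}"
      then have y: "y \<in> N u" by simp
      show "-4 \<le> gain u y"
        using g(1,2,4)[OF y] nbr_degree_ge_2[OF y] by fastforce
    qed
    moreover have "(\<Sum>y\<in>N u. gain u y) = gain u z + (\<Sum>y\<in>N u - {z}. gain u y)"
      using z by (intro sum.remove) auto
    ultimately show ?thesis using z assms by simp
  next
    case False
    have "(\<Sum>y\<in>N u. -2) \<le> (\<Sum>y\<in>N u. gain u y)"
    proof (intro sum_mono)
      fix y assume y: "y \<in> N u"
      show "-2 \<le> gain u y"
        using g(2,4)[OF y] nbr_degree_ge_2[OF y] False y by fastforce
    qed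
    then show ?thesis using assms by simp
  qed
  with pot assms show ?thesis by simp
qed

lemma final_charge_big_vertex:
  assumes "5 \<le> d x"
  shows "0 \<le> 10 * int (d x) - 28 + (\<Sum>y\<in>N x. gain x y) + pot x"
proof -
  define r :: int where "r = (if d x = k then 7 else if 8 \<le> d x then 6 else 4)"
  have "0 \<le> give y x" for y by (simp add: give_def)
  moreover have "give x y = r" for y using assms by (simp add: give_def r_def)
  ultimately have "(\<Sum>y\<in>N x. - r) \<le> (\<Sum>y\<in>N x. gain x y)" by (intro sum_mono) simp
  moreover have "pot x = (if d x = k then -2 else 0)"
    using assms by (simp add: pot_def in_pair_def tripod_def)
  ultimately show ?thesis using assms k_ge by (auto simp: r_def split: if_splits)
qed

lemma final_charge_nonneg:
  assumes "d x \<noteq> 0"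
  shows "0 \<le> 10 * int (d x) - 28 + (\<Sum>y\<in>N x. gain x y) + pot x"
proof -
  consider "d x = 2" | "d x = 3" | "d x = 4" | "5 \<le> d x" using assms degree_ne_1[of x] by linarith
  then show ?thesis using final_charge_2_vertex final_charge_3_vertex final_charge_4_vertex final_charge_big_vertex by cases
qed

text \<open>
  Sending charge along the edges does not change its total, and by \<open>connectors_le_hubs\<close> the pot never
  pays out more than it has received. So the total of the initial charges is nonnegative.
\<close>

lemma critical_graph_dense: "14 * card (Field A) \<le> 5 * card A"
proof -
  let ?V = "fst ` A"
  have V: "Field A = ?V" using sym_arcs by (auto simp: Field_def sym_def) force+
  have finV: "finite ?V" using finite_arcs by simp
  have Sig: "A = Sigma ?V N" by (force simp: nbrs_def)
  have pos: "x \<in> ?V" if "d x \<noteq> 0" for x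
    using that by (force simp: nbrs_def card_gt_0_iff)
  have "card A = (\<Sum>x\<in>?V. d x)" by (subst Sig) (rule card_SigmaI[OF finV], simp)
  then have degs: "(\<Sum>x\<in>?V. int (d x)) = int (card A)" by simp
  have arcs: "(\<Sum>x\<in>?V. \<Sum>y\<in>N x. f x y) = (\<Sum>(x, y)\<in>A. f x y)" for f :: "'a \<Rightarrow> 'a \<Rightarrow> int"
    by (subst (3) Sig, rule sum.Sigma[OF finV]) simp
  have "(\<Sum>(x, y)\<in>A. give y x) = (\<Sum>(x, y)\<in>A. give x y)"
    using sym_arcs by (intro sum.reindex_bij_witness[of _ prod.swap prod.swap]) (auto simp: sym_def)
  then have flow: "(\<Sum>x\<in>?V. \<Sum>y\<in>N x. gain x y) = 0"
    by (simp add: sum_subtractf arcs)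
  have count: "(\<Sum>x\<in>?V. of_bool (P x)) = int (card {x. P x})" if "\<And>x. P x \<Longrightarrow> d x \<noteq> 0" for P
  proof -
    have "?V \<inter> {x. P x} = {x. P x}" using that pos by blast
    then show ?thesis using finV by (simp add: sum_of_bool_eq)
  qed
  have "(\<Sum>x\<in>?V. pot x) = int (card {v. in_pair v}) + int (card {u. tripod u}) - 2 * int (card {x. d x = k})"
    unfolding pot_def sum_subtractf sum.distrib sum_distrib_left[symmetric]
    using count[of in_pair] count[of tripod] count[of "\<lambda>x. d x = k"] k_ge
    by (simp add: in_pair_def tripod_def)
  then have pots: "(\<Sum>x\<in>?V. pot x) \<le> 0" using connectors_le_hubs by linarith
  have "0 \<le> (\<Sum>x\<in>?V. 10 * int (d x) - 28 + (\<Sum>y\<in>N x. gain x y) + pot x)"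
  proof (intro sum_nonneg final_charge_nonneg)
    fix x assume "x \<in> ?V"
    then obtain y where "y \<in> N x" by (auto simp: nbrs_def)
    then show "d x \<noteq> 0" by (metis card_0_eq empty_iff finite_nbrs)
  qed
  also have "\<dots> = 10 * int (card A) - 28 * int (card ?V) + (\<Sum>x\<in>?V. pot x)"
    using flow degs by (simp add: sum.distrib sum_subtractf sum_distrib_left[symmetric])
  finally show ?thesis using pots V by simp
qed

end

section \<open>From the density of critical graphs to colourings of sparse graphs\<close>

theorem sparse_colourable:
  assumes "finite A" "sym A" "irrefl A" "\<And>x. card (nbrs A x) \<le> k" "10 \<le> k"
    and "\<And>B. B \<subseteq> A \<Longrightarrow> sym B \<Longrightarrow> B \<noteq> {} \<Longrightarrow> 5 * card B < 14 * card (Field B)"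
  shows "colourable_off A (k + 2) {}"
  using assms
proof (induction "card A" arbitrary: A rule: less_induct)
  case less
  show ?case
  proof (rule ccontr)
    assume no: "\<not> ?thesis"
    have fin: "finite (nbrs A x)" for x
    proof -
      have "nbrs A x \<subseteq> snd ` A" by (force simp: nbrs_def)
      then show ?thesis using less.prems(1) finite_subset by blast
    qed
    interpret critical_graph A k
    proof
      fix A' assume A': "A' \<subset> A" "sym A'"
      show "colourable_off A' (k + 2) {}"
      proof (rule less.hyps)
        show "card A' < card A" using A' less.prems(1) by (simp add: psubset_card_mono)
        show "finite A'" using A' less.prems(1) finite_subset by blast
        show "irrefl A'" using A' less.prems(3) by (auto simp: irrefl_def)
        show "card (nbrs A' x) \<le> k" for x
        proof -
          have "card (nbrs A' x) \<le> card (nbrs A x)"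
            using A'(1) fin by (intro card_mono) (auto simp: nbrs_def)
          then show ?thesis using less.prems(4) le_trans by blast
        qed
      qed (use A' less.prems in auto)
    qed (use less.prems no in auto)
    show False
    proof (cases "A = {}")
      case True
      have "colouring_off A (k + 2) {} (\<lambda>_. 1)"
        by (simp add: colouring_off_def near_def nbrs_def True)
      then show False using no by (auto simp: colourable_off_def)
    next
      case False
      then show False using critical_graph_dense less.prems(6)[of A] less.prems(2) by simp
    qed
  qed
qed

text \<open>
  At most two arcs have the same pair of ends.
\<close>

lemma card_le_edges:
  assumes "finite (parcs H)"
  shows "card (parcs H) \<le> 2 * card (edges H)"
proof -
  have "parcs H \<subseteq> (\<Union>e\<in>edges H. {p \<in> parcs H. {fst p, snd p} = e})"
    by (force simp: edges_def)
  then have "card (parcs H) \<le> card (\<Union>e\<in>edges H. {p \<in> parcs H. {fst p, snd p} = e})"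
    using assms by (intro card_mono) (auto simp: edges_def)
  also have "\<dots> \<le> (\<Sum>e\<in>edges H. card {p \<in> parcs H. {fst p, snd p} = e})"
    using assms by (intro card_UN_le) (simp add: edges_def)
  also have "\<dots> \<le> (\<Sum>e\<in>edges H. 2)"
  proof (intro sum_mono)
    fix e assume "e \<in> edges H"
    then obtain u v where e: "e = {u, v}" by (auto simp: edges_def)
    have "{p \<in> parcs H. {fst p, snd p} = e} \<subseteq> {(u, v), (v, u)}"
      by (auto simp: e doubleton_eq_iff)
    then have "card {p \<in> parcs H. {fst p, snd p} = e} \<le> card {(u, v), (v, u)}"
      by (intro card_mono) auto
    also have "\<dots> \<le> 2" using card_length[of "[(u, v), (v, u)]"] by simp
    finally show "card {p \<in> parcs H. {fst p, snd p} = e} \<le> 2" .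
  qed
  finally show ?thesis by simp
qed

text \<open>
  The arcs of \<open>B\<close> together with their ends form one of the subgraphs over which the maximum average degree
  is taken, and it has \<open>card B\<close> as the sum of its degrees.
\<close>

lemma sparse_of_mad:
  assumes G: "pair_graph G" and mad: "mad G < 14 / 5"
    and B: "B \<subseteq> parcs G" "sym B" "B \<noteq> {}"
  shows "5 * card B < 14 * card (Field B)"
proof -
  interpret pair_graph G by fact
  let ?H = "\<lparr>pverts = Field B, parcs = B\<rparr>"
  have "finite B" by (rule finite_subset[OF B(1) pair_finite_arcs])
  then have finF: "finite (Field B)" by (simp add: finite_Field)
  have Fsub: "Field B \<subseteq> pverts G" using B(1) by (auto simp: Field_def dest: in_arcsD1 in_arcsD2)
  have ne: "Field B \<noteq> {}" using B(3) by (auto simp: Field_def)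
  interpret H: pair_graph ?H
  proof
    show "finite (pverts ?H)" "finite (parcs ?H)" using finF \<open>finite B\<close> by simp_all
    show "fst e \<in> pverts ?H" "snd e \<in> pverts ?H" if "e \<in> parcs ?H" for e
      using that by (auto simp: Field_def image_iff Domain_fst Range_snd)
    show "fst e \<noteq> snd e" if "e \<in> parcs ?H" for e
      using that B(1) pair_no_loops by auto
    show "symmetric (with_proj ?H)"
      using B(2) by (simp add: symmetric_def arcs_ends_conv)
  qed
  have "subgraph (with_proj ?H) (with_proj G)"
    using Fsub B(1) wf_digraph H.wf_digraph by (simp add: subgraph_def compatible_def)
  moreover have "pair_graph ?H" by unfold_locales
  ultimately have "?H \<in> nonempty_subgraphs G" using ne by (simp add: nonempty_subgraphs_def)
  then have "2 * real (card (edges ?H)) / real (card (pverts ?H)) \<le> mad G"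
    unfolding mad_def using finite_nonempty_subgraphs[OF G]
    by (intro Max_ge finite_imageI image_eqI[where x = ?H]) auto
  with mad have "2 * real (card (edges ?H)) / real (card (Field B)) < 14 / 5" by simp
  moreover have "0 < card (Field B)" using ne finF by (simp add: card_gt_0_iff)
  ultimately have "5 * (2 * real (card (edges ?H))) < 14 * real (card (Field B))"
    by (simp add: field_simps)
  then have "5 * (2 * card (edges ?H)) < 14 * card (Field B)" by linarith
  moreover have "card B \<le> 2 * card (edges ?H)" using card_le_edges[of ?H] \<open>finite B\<close> by simp
  ultimately show ?thesis by linarith
qed

theorem theorem4:
  fixes G :: "'a pair_pre_digraph"
  assumes "pair_graph G"
    and "max_degree G \<ge> 10"
    and "mad G < 14 / 5"
  shows "\<exists>\<phi>. two_distance_coloring G (max_degree G + 2) \<phi>"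
proof -
  interpret pair_graph G by fact
  have degree: "card (nbrs (parcs G) x) \<le> max_degree G" for x
  proof (cases "x \<in> pverts G")
    case True
    have "out_arcs (with_proj G) x = Pair x ` nbrs (parcs G) x"
      by (auto simp: out_arcs_def nbrs_def)
    then have "out_degree (with_proj G) x = card (nbrs (parcs G) x)"
      by (simp add: out_degree_def card_image inj_on_def)
    moreover have "out_degree (with_proj G) x \<le> max_degree G"
      unfolding max_degree_def using True pair_finite_verts by (intro Max_ge) auto
    ultimately show ?thesis by simp
  next
    case False
    then have "nbrs (parcs G) x = {}" using in_arcsD1 by (auto simp: nbrs_def)
    then show ?thesis by simp
  qed
  have sym: "sym (parcs G)" using arcs_symmetric by (auto simp: sym_def)
  have irrefl: "irrefl (parcs G)" using pair_no_loops by (fastforce simp: irrefl_def)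
  have "colourable_off (parcs G) (max_degree G + 2) {}"
    by (rule sparse_colourable[OF pair_finite_arcs sym irrefl degree assms(2) sparse_of_mad[OF assms(1,3)]])
  then obtain \<phi> where \<phi>: "colouring_off (parcs G) (max_degree G + 2) {} \<phi>"
    by (auto simp: colourable_off_def)
  have "two_distance_coloring G (max_degree G + 2) \<phi>"
    unfolding two_distance_coloring_def
  proof (intro conjI ballI impI)
    show "\<phi> ` pverts G \<subseteq> {1..max_degree G + 2}" using \<phi> by (auto simp: colouring_off_def)
  next
    fix x y assume "x \<in> pverts G" "y \<in> pverts G" "x \<noteq> y \<and> graph_dist G x y \<le> 2"
    then have "y \<in> near (parcs G) x"
      using graph_dist_le_2_iff[OF assms(1)] by (auto simp: near_def nbrs_def)
    then show "\<phi> x \<noteq> \<phi> y" using \<phi> by (auto simp: colouring_off_def)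
  qed
  then show ?thesis by blast
qed

end
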